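(* Let $m>n$ and suppose $(F,G,B):\mathbb R^n\to gl_*(n)\times\mathcal M_{(m-n)\times n}\times O(n)$ is a solution of the $G_{m,n}$-system II. Let $F=(f_{ij})$, $G=(g_{ij})$, $B=(b_{ij})$. Then: (i) $$\tau=\sum_{i=1}^n\begin{pmatrix}-FC_i+C_iF^t&C_iG^t\\-GC_i&0\end{pmatrix}dx_i$$ is a flat $o(m)$-valued connection 1-form. Hence there exists $A:\mathbb R^n\to O(m)$ such that $A^{-1}dA=\tau$. (ii) Write $A=(A_1,A_2)$ with $A_1\in\mathcal M_{m\times n}$ and $A_2\in\mathcal M_{m\times(m-n)}$. Then $\sum_{i=1}^nA_1C_iB^t\,dx_i$ is exact. So there exists a map $X:\mathbb R^n\to\mathcal M_{m\times n}$ such that $$dX=-\sum_{i=1}^nA_1C_iB^t\,dx_i.$$ (iii) Suppose all the entries of $B$ are non-zero. Let $X_j:\mathbb R^n\to\mathbb R^m$ denote the $j$-th column of $X$, and $e_i$ the $i$-th column of $A$. Then $(X_1,\dots,X_n)$ is an $n$-tuple in $\mathbb R^m$ of type $O(n)$. In fact: (1) $e_1,\dots,e_n$ are tangent to $X_j$ for all $1\le j\le n$, so the tangent planes of $X_1,\dots,X_n$ are parallel; (2) $\{e_{n+1},\dots,e_m\}$ is a parallel normal frame for each $X_j$; (3) the two fundamental forms of the immersion $X_j$ are $$I_j=\sum_{i=1}^nb_{ji}^2\,dx_i^2,\qquad II_j=-\sum_{i=1}^n\sum_{k=1}^{m-n}g_{ki}b_{ji}\,dx_i^2\,e_{n+k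}.$$
   Context: $\mathcal M_{p\times q}$: real $p\times q$ matrices; $gl_*(n)$: real $n\times n$ matrices with zero diagonal; $C_i$: the $n\times n$ matrix whose only non-zero entry is a $1$ at $(i,i)$. A matrix-valued 1-form $\tau$ is flat if $d\tau+\tau\wedge\tau=0$. The $G_{m,n}$-system II is: $(f_{ij})_{x_i}+(f_{ji})_{x_j}+\sum_{k=1}^nf_{ki}f_{kj}+\sum_{k=1}^{m-n}g_{ki}g_{kj}=0$ if $i\ne j$; $(f_{ij})_{x_k}=f_{ik}f_{kj}$ if $i,j,k$ are distinct; $(b_{ij})_{x_k}=f_{kj}b_{ik}$ if $j\ne k$; $(g_{ij})_{x_k}=f_{kj}g_{ik}$ if $j\ne k$. $n$-tuple of type $O(n)$: let $m>n$, $\mathcal O$ a domain in $\mathbb R^n$, and $X_i:\mathcal O\to\mathbb R^m$ an immersion with flat and non-degenerate normal bundle for $1\le i\le n$. $(X_1,\dots,X_n)$ is an $n$-tuple in $\mathbb R^m$ of type $O(n)$ if (a) the normal planes of $X_i(x)$ and $X_j(x)$ are parallel for all $i,j$ and $x\in\mathcal O$; (b) there exists a common parallel normal frame $\{e_\alpha\}_{\alpha=n+1}^m$; (c) $x\in\mathcal O$ is a spherical line of curvature coordinate system with respect to $\{e_\alpha\}$ for each $X_j$, such that the fundamental forms of $X_j$ are $I_j=\sum_i\beta_{ji}^2dx_i^2$, $II_j=\sum_{i,k}\beta_{ji}\gamma_{ki}dx_i^2e_{n+k}$ for some $O(n)$-valued map $(\beta_{ij})$ and $\mathcal M_{(m-n)\times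 n}$-valued map $(\gamma_{ij})$. The normal bundle of an $n$-dimensional submanifold is non-degenerate if at each point the space of shape operators $\{A_v:v\text{ normal}\}$ has dimension $n$. Line of curvature coordinates with respect to an orthonormal parallel normal frame are coordinates with $I=\sum_ia_i^2dx_i^2$ and $II=\sum_{i,j}c_{ji}dx_i^2e_{n+j}$; spherical means in addition $\sum_ia_i^2=1$. Convention: with $\omega_i=\langle dX,e_i\rangle$, $\omega_{i\alpha}=\langle e_i,de_\alpha\rangle$ for an orthonormal tangent frame $e_i$ and normal frame $e_\alpha$, $I=\sum\omega_i^2$, $II=\sum_{i,\alpha}\omega_{i\alpha}\omega_ie_\alpha$.
   Formalization: The normal bundles of the X_j need not be non-degenerate (F=0, G=0, B constant gives affine planes), so in (iii) all other conditions of an n-tuple of type O(n) are proved, and the full notion is shown to hold exactly when G has rank n at every point. *)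

theory Defs
  imports "HOL-Analysis.Analysis"
begin

text \<open>
  Throughout, \<open>n\<close> is the cardinality of the index type \<open>'n\<close>, \<open>m - n\<close> that of \<open>'p\<close>, and
  \<open>m\<close> that of \<open>'n + 'p\<close>; so \<open>m > n\<close> holds because types are nonempty.  The index
  \<open>Inl i\<close> stands for \<open>i \<le> n\<close> and \<open>Inr k\<close> for \<open>n + k\<close>.  Recall that \<open>real^'c^'r\<close> is the
  type of matrices with rows indexed by \<open>'r\<close> and columns by \<open>'c\<close>.
\<close>

subsection \<open>Smooth maps and 1-forms\<close>

text \<open>This is the usual partial derivative wherever \<open>f\<close> is differentiable; it is only used there.\<close>

definition pderiv_at :: "(real^'n::finite \<Rightarrow> 'b::real_normed_vector) \<Rightarrow> 'n \<Rightarrow> real^'n \<Rightarrow> 'b"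
  where "pderiv_at f i x = frechet_derivative f (at x) (axis i 1)"

primrec Ck_on :: "nat \<Rightarrow> (real^'n::finite) set \<Rightarrow> (real^'n \<Rightarrow> 'b::real_normed_vector) \<Rightarrow> bool"
  where
    "Ck_on 0 S f \<longleftrightarrow> continuous_on S f"
  | "Ck_on (Suc k) S f \<longleftrightarrow>
       (\<forall>x\<in>S. f differentiable (at x)) \<and> (\<forall>i. Ck_on k S (pderiv_at f i))"

definition smooth_map_on :: "(real^'n::finite) set \<Rightarrow> (real^'n \<Rightarrow> 'b::real_normed_vector) \<Rightarrow> bool"
  where "smooth_map_on S f \<longleftrightarrow> (\<forall>k. Ck_on k S f)"

text \<open>
  A 1-form \<open>\<omega>\<close> is given by \<open>\<omega> x v\<close>, the value at the point \<open>x\<close> on the tangent vector \<open>v\<close>;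
  in particular \<open>dx\<^sub>i\<close> is \<open>\<lambda>x v. v $ i\<close>.
\<close>

definition one_form_on ::
    "(real^'n::finite) set \<Rightarrow> (real^'n \<Rightarrow> real^'n \<Rightarrow> 'b::real_normed_vector) \<Rightarrow> bool"
  where "one_form_on S \<omega> \<longleftrightarrow>
    (\<forall>x\<in>S. linear (\<omega> x)) \<and> (\<forall>v. smooth_map_on S (\<lambda>x. \<omega> x v))"

definition ext_deriv ::
    "(real^'n::finite \<Rightarrow> real^'n \<Rightarrow> 'b::real_normed_vector) \<Rightarrow> real^'n \<Rightarrow> real^'n \<Rightarrow> real^'n \<Rightarrow> 'b"
  where "ext_deriv \<omega> x u v =
    frechet_derivative (\<lambda>y. \<omega> y v) (at x) u - frechet_derivative (\<lambda>y. \<omega> y u) (at x) v"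

definition wedge_square ::
    "(real^'n::finite \<Rightarrow> real^'n \<Rightarrow> real^'m^'m) \<Rightarrow> real^'n \<Rightarrow> real^'n \<Rightarrow> real^'n \<Rightarrow> real^'m::finite^'m"
  where "wedge_square \<omega> x u v = \<omega> x u ** \<omega> x v - \<omega> x v ** \<omega> x u"

definition flat_form_on ::
    "(real^'n::finite) set \<Rightarrow> (real^'n \<Rightarrow> real^'n \<Rightarrow> real^'m::finite^'m) \<Rightarrow> bool"
  where "flat_form_on S \<omega> \<longleftrightarrow> (\<forall>x\<in>S. \<forall>u v. ext_deriv \<omega> x u v + wedge_square \<omega> x u v = 0)"

definition has_differential_on ::
    "(real^'n::finite \<Rightarrow> 'b::real_normed_vector) \<Rightarrow> (real^'n \<Rightarrow> real^'n \<Rightarrow> 'b) \<Rightarrow> (real^'n) set \<Rightarrow> bool"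
  where "has_differential_on f \<omega> S \<longleftrightarrow>
    smooth_map_on S f \<and> (\<forall>x\<in>S. (f has_derivative \<omega> x) (at x))"

definition exact_on ::
    "(real^'n::finite) set \<Rightarrow> (real^'n \<Rightarrow> real^'n \<Rightarrow> 'b::real_normed_vector) \<Rightarrow> bool"
  where "exact_on S \<omega> \<longleftrightarrow> (\<exists>f. has_differential_on f \<omega> S)"


subsection \<open>The system and its connection form\<close>

definition gl_star :: "(real^'n^'n::finite) set"
  where "gl_star = {M. \<forall>i. M $ i $ i = 0}"

definition so_algebra :: "(real^'m^'m::finite) set"
  where "so_algebra = {M. transpose M = - M}"

definition C_mat :: "'n \<Rightarrow> real^'n^'n::finite"
  where "C_mat i = (\<chi> a b. if a = i \<and> b = i then 1 else 0)"

definition block_mat ::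
    "real^'n^'n \<Rightarrow> real^'p^'n \<Rightarrow> real^'n^'p \<Rightarrow> real^'p^'p
     \<Rightarrow> real^('n::finite + 'p::finite)^('n + 'p)"
  where "block_mat P Q R T = (\<chi> r c. case r of
      Inl a \<Rightarrow> (case c of Inl b \<Rightarrow> P $ a $ b | Inr l \<Rightarrow> Q $ a $ l)
    | Inr k \<Rightarrow> (case c of Inl b \<Rightarrow> R $ k $ b | Inr l \<Rightarrow> T $ k $ l))"

definition left_cols :: "real^('n::finite + 'p::finite)^('n + 'p) \<Rightarrow> real^'n^('n + 'p)"
  where "left_cols A = (\<chi> r c. A $ r $ Inl c)"

definition G_system_II ::
    "(real^'n \<Rightarrow> real^'n^'n) \<Rightarrow> (real^'n \<Rightarrow> real^'n^'p) \<Rightarrow> (real^'n \<Rightarrow> real^'n^'n)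
     \<Rightarrow> (real^'n::finite) set \<Rightarrow> bool"
  where "G_system_II F G B S \<longleftrightarrow> (\<forall>x\<in>S.
      (\<forall>i j. i \<noteq> j \<longrightarrow>
         pderiv_at (\<lambda>y. F y $ i $ j) i x + pderiv_at (\<lambda>y. F y $ j $ i) j x
         + (\<Sum>k\<in>UNIV. F x $ k $ i * F x $ k $ j)
         + (\<Sum>k\<in>UNIV. G x $ k $ i * G x $ k $ j) = 0)
    \<and> (\<forall>i j k. i \<noteq> j \<and> j \<noteq> k \<and> i \<noteq> k \<longrightarrow>
         pderiv_at (\<lambda>y. F y $ i $ j) k x = F x $ i $ k * F x $ k $ j)
    \<and> (\<forall>i j k. j \<noteq> k \<longrightarrow>
         pderiv_at (\<lambda>y. B y $ i $ j) k x = F x $ k $ j * B x $ i $ k)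
    \<and> (\<forall>i j k. j \<noteq> k \<longrightarrow>
         pderiv_at (\<lambda>y. G y $ i $ j) k x = F x $ k $ j * G x $ i $ k))"

definition tau_form ::
    "(real^'n \<Rightarrow> real^'n^'n) \<Rightarrow> (real^'n \<Rightarrow> real^'n^'p)
     \<Rightarrow> real^'n \<Rightarrow> real^'n \<Rightarrow> real^('n::finite + 'p::finite)^('n + 'p)"
  where "tau_form F G x v = (\<Sum>i\<in>UNIV. v $ i *\<^sub>R
    block_mat (- (F x ** C_mat i) + C_mat i ** transpose (F x)) (C_mat i ** transpose (G x))
              (- (G x ** C_mat i))                              0)"

text \<open>\<open>A\<close> is a smooth \<open>O(m)\<close>-valued map with \<open>A\<^sup>-\<^sup>1 dA = \<omega>\<close>.\<close>

definition trivializes_on ::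
    "(real^'n::finite \<Rightarrow> real^'m::finite^'m) \<Rightarrow> (real^'n \<Rightarrow> real^'n \<Rightarrow> real^'m^'m) \<Rightarrow> (real^'n) set \<Rightarrow> bool"
  where "trivializes_on A \<omega> S \<longleftrightarrow>
    smooth_map_on S A \<and> (\<forall>x\<in>S. orthogonal_matrix (A x)) \<and>
    (\<forall>x\<in>S. \<forall>v. matrix_inv (A x) ** frechet_derivative A (at x) v = \<omega> x v)"

definition ACB_form ::
    "(real^'n \<Rightarrow> real^('n + 'p)^('n + 'p)) \<Rightarrow> (real^'n \<Rightarrow> real^'n^'n)
     \<Rightarrow> real^'n \<Rightarrow> real^'n \<Rightarrow> real^'n^('n::finite + 'p::finite)"
  where "ACB_form A B x v =
    (\<Sum>i\<in>UNIV. v $ i *\<^sub>R (left_cols (A x) ** C_mat i ** transpose (B x)))"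


subsection \<open>Immersed submanifolds of Euclidean space\<close>

definition immersion_on :: "(real^'n::finite) set \<Rightarrow> (real^'n \<Rightarrow> 'a::euclidean_space) \<Rightarrow> bool"
  where "immersion_on S X \<longleftrightarrow>
    smooth_map_on S X \<and> (\<forall>x\<in>S. inj (frechet_derivative X (at x)))"

definition tangent_plane :: "(real^'n::finite \<Rightarrow> 'a::euclidean_space) \<Rightarrow> real^'n \<Rightarrow> 'a set"
  where "tangent_plane X x = range (frechet_derivative X (at x))"

definition normal_plane :: "(real^'n::finite \<Rightarrow> 'a::euclidean_space) \<Rightarrow> real^'n \<Rightarrow> 'a set"
  where "normal_plane X x = orthogonal_comp (tangent_plane X x)"

definition normal_part :: "(real^'n::finite \<Rightarrow> 'a::euclidean_space) \<Rightarrow> real^'n \<Rightarrow> 'a \<Rightarrow> 'a"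
  where "normal_part X x w = (THE z. z \<in> normal_plane X x \<and> w - z \<in> tangent_plane X x)"

definition normal_field_on ::
    "(real^'n::finite) set \<Rightarrow> (real^'n \<Rightarrow> 'a::euclidean_space) \<Rightarrow> (real^'n \<Rightarrow> 'a) \<Rightarrow> bool"
  where "normal_field_on S X \<xi> \<longleftrightarrow> smooth_map_on S \<xi> \<and> (\<forall>x\<in>S. \<xi> x \<in> normal_plane X x)"

text \<open>The covariant derivative of \<open>\<xi>\<close> along \<open>u\<close> for the normal connection.\<close>

definition normal_deriv ::
    "(real^'n::finite \<Rightarrow> 'a::euclidean_space) \<Rightarrow> real^'n \<Rightarrow> (real^'n \<Rightarrow> 'a) \<Rightarrow> real^'n \<Rightarrow> 'a"
  where "normal_deriv X u \<xi> x = normal_part X x (frechet_derivative \<xi> (at x) u)"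

text \<open>
  Vanishing curvature of the normal connection; \<open>u\<close> and \<open>v\<close> are constant vector fields, whose
  bracket is zero.
\<close>

definition flat_normal_bundle_on ::
    "(real^'n::finite) set \<Rightarrow> (real^'n \<Rightarrow> 'a::euclidean_space) \<Rightarrow> bool"
  where "flat_normal_bundle_on S X \<longleftrightarrow> (\<forall>\<xi>. normal_field_on S X \<xi> \<longrightarrow>
    (\<forall>x\<in>S. \<forall>u v. normal_deriv X u (normal_deriv X v \<xi>) x = normal_deriv X v (normal_deriv X u \<xi>) x))"

definition parallel_normal_field_on ::
    "(real^'n::finite) set \<Rightarrow> (real^'n \<Rightarrow> 'a::euclidean_space) \<Rightarrow> (real^'n \<Rightarrow> 'a) \<Rightarrow> bool"
  where "parallel_normal_field_on S X \<xi> \<longleftrightarrow>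
    normal_field_on S X \<xi> \<and> (\<forall>x\<in>S. \<forall>u. normal_deriv X u \<xi> x = 0)"

definition parallel_normal_frame_on ::
    "(real^'n::finite) set \<Rightarrow> (real^'n \<Rightarrow> 'a::euclidean_space) \<Rightarrow> ('p::finite \<Rightarrow> real^'n \<Rightarrow> 'a) \<Rightarrow> bool"
  where "parallel_normal_frame_on S X e \<longleftrightarrow>
    (\<forall>k. parallel_normal_field_on S X (e k)) \<and>
    (\<forall>x\<in>S. (\<forall>k l. e k x \<bullet> e l x = (if k = l then 1 else 0)) \<and>
            span (range (\<lambda>k. e k x)) = normal_plane X x)"

text \<open>
  The shape operator \<open>A\<^sub>v\<close>, transported to \<open>\<real>\<^sup>n\<close> by \<open>dX\<close>: it is determined by
  \<open>\<langle>dX (A\<^sub>v u), dX w\<rangle> = \<langle>d\<^sup>2X (u, w), v\<rangle>\<close>, i.e. \<open>dX (A\<^sub>v u)\<close> is minus the tangential part of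
  \<open>d\<xi> u\<close> for any normal field \<open>\<xi>\<close> through \<open>v\<close>.
\<close>

definition shape_operator ::
    "(real^'n::finite \<Rightarrow> 'a::euclidean_space) \<Rightarrow> real^'n \<Rightarrow> 'a \<Rightarrow> real^'n \<Rightarrow> real^'n"
  where "shape_operator X x v u = (THE z. \<forall>w.
    frechet_derivative X (at x) z \<bullet> frechet_derivative X (at x) w =
    frechet_derivative (\<lambda>y. frechet_derivative X (at y) w) (at x) u \<bullet> v)"

text \<open>Shape operators are represented by matrices so that the library's \<open>dim\<close> applies.\<close>

definition nondegenerate_normal_bundle_on ::
    "(real^'n::finite) set \<Rightarrow> (real^'n \<Rightarrow> 'a::euclidean_space) \<Rightarrow> bool"
  where "nondegenerate_normal_bundle_on S X \<longleftrightarrow>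
    (\<forall>x\<in>S. dim ((\<lambda>v. matrix (shape_operator X x v)) ` normal_plane X x) = CARD('n))"

text \<open>
  The fundamental forms as bilinear forms.  For an orthonormal tangent frame \<open>e\<^sub>i\<close> and
  \<open>\<omega>\<^sub>i = \<langle>dX, e\<^sub>i\<rangle>\<close>, \<open>\<omega>\<^sub>i\<^sub>\<alpha> = \<langle>e\<^sub>i, de\<^sub>\<alpha>\<rangle>\<close> one has \<open>dX = \<Sum>\<^sub>i \<omega>\<^sub>i e\<^sub>i\<close>, so that
  \<open>\<Sum>\<^sub>i \<omega>\<^sub>i\<^sup>2 = \<langle>dX, dX\<rangle>\<close> and \<open>\<Sum>\<^sub>i \<omega>\<^sub>i\<^sub>\<alpha> \<omega>\<^sub>i = \<langle>de\<^sub>\<alpha>, dX\<rangle>\<close>.  This convention for \<open>II\<close> is the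
  negative of the one with \<open>\<langle>II, e\<^sub>\<alpha>\<rangle> = \<langle>d\<^sup>2X, e\<^sub>\<alpha>\<rangle>\<close>.
\<close>

definition first_form ::
    "(real^'n::finite \<Rightarrow> 'a::euclidean_space) \<Rightarrow> real^'n \<Rightarrow> real^'n \<Rightarrow> real^'n \<Rightarrow> real"
  where "first_form X x u v = frechet_derivative X (at x) u \<bullet> frechet_derivative X (at x) v"

definition second_form ::
    "(real^'n::finite \<Rightarrow> 'a::euclidean_space) \<Rightarrow> ('p::finite \<Rightarrow> real^'n \<Rightarrow> 'a)
     \<Rightarrow> real^'n \<Rightarrow> real^'n \<Rightarrow> real^'n \<Rightarrow> 'a"
  where "second_form X e x u v = (\<Sum>k\<in>UNIV.
    (frechet_derivative (e k) (at x) u \<bullet> frechet_derivative X (at x) v) *\<^sub>R e k x)"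

text \<open>\<open>I = \<Sum>\<^sub>i a\<^sub>i\<^sup>2 dx\<^sub>i\<^sup>2\<close> and \<open>II = \<Sum>\<^sub>i\<^sub>,\<^sub>k c\<^sub>k\<^sub>i dx\<^sub>i\<^sup>2 e\<^sub>n\<^sub>+\<^sub>k\<close>, where \<open>dx\<^sub>i\<^sup>2 (u, v) = u\<^sub>i v\<^sub>i\<close>.\<close>

definition fundamental_forms_on ::
    "(real^'n::finite) set \<Rightarrow> (real^'n \<Rightarrow> 'a::euclidean_space) \<Rightarrow> ('p::finite \<Rightarrow> real^'n \<Rightarrow> 'a)
     \<Rightarrow> (real^'n \<Rightarrow> real^'n) \<Rightarrow> (real^'n \<Rightarrow> real^'n^'p) \<Rightarrow> bool"
  where "fundamental_forms_on S X e a c \<longleftrightarrow> (\<forall>x\<in>S. \<forall>u v.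
    first_form X x u v = (\<Sum>i\<in>UNIV. (a x $ i)\<^sup>2 * (u $ i * v $ i)) \<and>
    second_form X e x u v = (\<Sum>i\<in>UNIV. \<Sum>k\<in>UNIV. (c x $ k $ i * (u $ i * v $ i)) *\<^sub>R e k x))"

definition spherical_curvature_coords_on ::
    "(real^'n::finite) set \<Rightarrow> (real^'n \<Rightarrow> 'a::euclidean_space) \<Rightarrow> ('p::finite \<Rightarrow> real^'n \<Rightarrow> 'a) \<Rightarrow> bool"
  where "spherical_curvature_coords_on S X e \<longleftrightarrow> parallel_normal_frame_on S X e \<and>
    (\<exists>a c. smooth_map_on S a \<and> smooth_map_on S c \<and> fundamental_forms_on S X e a c \<and>
           (\<forall>x\<in>S. (\<Sum>i\<in>UNIV. (a x $ i)\<^sup>2) = 1))"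


subsection \<open>Tuples of type \<open>O(n)\<close>\<close>

text \<open>
  Non-degeneracy of the normal bundles is kept apart from the remaining conditions, because
  a solution of the system need not give it: for \<open>F = 0\<close>, \<open>G = 0\<close> and constant \<open>B\<close> the
  immersions parametrize affine subspaces, whose shape operators vanish.  In general the
  shape operators at \<open>x\<close> span a space of dimension \<open>rank (G x)\<close>.
\<close>

definition On_tuple_pre ::
    "(real^'n) set \<Rightarrow> ('n \<Rightarrow> real^'n \<Rightarrow> real^('n::finite + 'p::finite)) \<Rightarrow> bool"
  where "On_tuple_pre S X \<longleftrightarrow>
    open S \<and> connected S \<and> S \<noteq> {} \<and>
    (\<forall>j. immersion_on S (X j) \<and> flat_normal_bundle_on S (X j)) \<and>
    (\<forall>i j. \<forall>x\<in>S. normal_plane (X i) x = normal_plane (X j) x) \<and>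
    (\<exists>e :: 'p \<Rightarrow> real^'n \<Rightarrow> real^('n + 'p).
       (\<forall>j. parallel_normal_frame_on S (X j) e) \<and>
       (\<forall>j. spherical_curvature_coords_on S (X j) e) \<and>
       (\<exists>\<beta> \<gamma>. smooth_map_on S \<beta> \<and> smooth_map_on S \<gamma> \<and>
          (\<forall>x\<in>S. orthogonal_matrix (\<beta> x)) \<and>
          (\<forall>j. fundamental_forms_on S (X j) e
                 (\<lambda>x. \<beta> x $ j) (\<lambda>x. \<chi> k i. \<beta> x $ j $ i * \<gamma> x $ k $ i))))"

definition On_tuple ::
    "(real^'n) set \<Rightarrow> ('n \<Rightarrow> real^'n \<Rightarrow> real^('n::finite + 'p::finite)) \<Rightarrow> bool"
  where "On_tuple S X \<longleftrightarrow>
    On_tuple_pre S X \<and> (\<forall>j. nondegenerate_normal_bundle_on S (X j))"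

end

theory Submission
  imports Defs
begin

text \<open>
  Writing \<open>w\<^sub>i\<close> for the \<open>i\<close>-th column of \<open>F\<close> on top of that of \<open>G\<close>, the coefficients of the connection are
  \<open>\<tau>\<^sub>i = \<epsilon>\<^sub>i w\<^sub>i\<^sup>T - w\<^sub>i \<epsilon>\<^sub>i\<^sup>T\<close>, and the first, second and fourth equations of the system say exactly that
  \<open>\<tau>\<close> is flat.  Flatness makes \<open>dA = A \<tau>\<close> solvable: the solution along the rays from \<open>0\<close> is a sum
  of iterated integrals, and a Gronwall estimate based on flatness shows that it solves the system in all
  directions; \<open>A A\<^sup>T\<close> is constant because \<open>\<tau>\<close> is skew.  Since
  \<open>\<partial>\<^sub>k e\<^sub>i = f\<^sub>i\<^sub>k e\<^sub>k\<close> for \<open>i \<noteq> k\<close>, the third equation makes \<open>\<Sum>\<^sub>i b\<^sub>j\<^sub>i e\<^sub>i dx\<^sub>i\<close> closed, hence exact.  The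
  immersions then satisfy \<open>dX\<^sub>j = - \<Sum>\<^sub>i b\<^sub>j\<^sub>i e\<^sub>i dx\<^sub>i\<close> and \<open>de\<^sub>n\<^sub>+\<^sub>k = \<Sum>\<^sub>i g\<^sub>k\<^sub>i e\<^sub>i dx\<^sub>i\<close>, from which the planes,
  the forms and the shape operators can be read off.
\<close>

section \<open>Calculus of smooth maps\<close>

text \<open>One existence theorem serves twice: the product in dy = y \<Omega> is an arbitrary
  bounded bilinear map, so that matrix multiplication yields \<open>A\<close> and a degenerate
  product on R x E yields primitives of closed forms. Integration along rays leaves one real
  parameter, but controls only the radial derivative. The obstacle is that in all other directions
  the candidate is merely known to be continuous; so the linear approximation predicted by the
  equation is compared with it along a ray, instead of differentiating the iterates. Higher
  smoothness is read off from the equation itself. In the study of the immersions, second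
  derivatives are paired with normal vectors only, and such a pairing is obtained by differentiating
  an orthogonality relation; the differentials of X_j and of the normal frame therefore suffice. A
  row of \<open>B\<close> and its negative define the same metric, so the minus sign of dX_j
  survives only in the second form.\<close>

lemma pderiv_at_eqI:
  assumes "(f has_derivative f') (at x)"
  shows "pderiv_at f i x = f' (axis i 1)"
  using frechet_derivative_at[OF assms] by (simp add: pderiv_at_def)

lemma pderiv_at_cong:
  assumes "open S" "x \<in> S" "\<And>y. y \<in> S \<Longrightarrow> f y = g y" "f differentiable (at x)"
  shows "pderiv_at f i x = pderiv_at g i x"
  using frechet_derivative_transform_within_open[of f x S g] assms
  by (simp add: pderiv_at_def)

lemma Ck_on_cong:
  assumes "open S" "\<And>x. x \<in> S \<Longrightarrow> f x = g x"
  shows "Ck_on k S f \<longleftrightarrow> Ck_on k S g"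
proof -
  \<comment> \<open>One implication is enough, since the hypothesis is symmetric. Both maps must
    vary because the induction passes to their partial derivatives.\<close>
  have "Ck_on k S g" if "Ck_on k S f" "\<And>x. x \<in> S \<Longrightarrow> f x = g x"
    for f g :: "real^'a \<Rightarrow> 'b"
    using that
  proof (induction k arbitrary: f g)
    case 0
    then show ?case by (auto cong: continuous_on_cong)
  next
    case (Suc k)
    have "g differentiable (at x)" if "x \<in> S" for x
    proof -
      have "f differentiable (at x)" using Suc.prems(1) that by simp
      then obtain f' where "(f has_derivative f') (at x)" by (auto simp: differentiable_def)
      then have "(g has_derivative f') (at x)"
        by (rule has_derivative_transform_within_open[OF _ \<open>open S\<close> that]) (rule Suc.prems(2))
      then show ?thesis by (auto simp: differentiable_def)
    qed
    moreover have "Ck_on k S (pderiv_at g i)" for i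
    proof (rule Suc.IH)
      show "Ck_on k S (pderiv_at f i)" using Suc.prems(1) by simp
      show "pderiv_at f i x = pderiv_at g i x" if "x \<in> S" for x
        using Suc.prems(1) that by (intro pderiv_at_cong[OF \<open>open S\<close> that Suc.prems(2)]) simp_all
    qed
    ultimately show ?case by simp
  qed
  then show ?thesis using assms by metis
qed

text \<open>The successor clause mentions only differentiability and partial derivatives, so the
  lower classes have to be recovered, starting from the continuity of differentiable maps.\<close>

lemma Ck_on_SucD: "Ck_on (Suc k) S f \<Longrightarrow> Ck_on k S f"
proof (induction k arbitrary: f)
  case 0
  then show ?case
    by (auto simp: continuous_on_eq_continuous_within differentiable_imp_continuous_within
        intro: continuous_at_imp_continuous_at_within)
next
  case (Suc k)
  then show ?case by (simp only: Ck_on.simps) blast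
qed

text \<open>Lets an explicit derivative formula stand in for \<open>pderiv_at\<close>; each closure
  rule below is a differentiation rule fed through this criterion.\<close>

lemma Ck_on_SucI:
  assumes "open S" "\<And>x. x \<in> S \<Longrightarrow> (f has_derivative f' x) (at x)"
    "\<And>i. Ck_on k S (\<lambda>x. f' x (axis i 1))"
  shows "Ck_on (Suc k) S f"
proof -
  have "Ck_on k S (pderiv_at f i)" for i
    using assms(3)[of i] Ck_on_cong[OF \<open>open S\<close>, of "pderiv_at f i" "\<lambda>x. f' x (axis i 1)" k]
      pderiv_at_eqI[OF assms(2)] by auto
  then show ?thesis using assms(2) by (auto simp: differentiable_def)
qed

lemma Ck_on_Suc_has_derivative:
  "Ck_on (Suc k) S f \<Longrightarrow> x \<in> S \<Longrightarrow> (f has_derivative frechet_derivative f (at x)) (at x)"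
  by (simp add: frechet_derivative_works)

lemma Ck_on_const: "open S \<Longrightarrow> Ck_on k S (\<lambda>x. c)"
proof (induction k arbitrary: c)
  case (Suc k)
  show ?case
    by (rule Ck_on_SucI[where f' = "\<lambda>_ _. 0"]) (use Suc in auto)
qed simp

lemma Ck_on_add:
  assumes "open S" "Ck_on k S f" "Ck_on k S g"
  shows "Ck_on k S (\<lambda>x. f x + g x)"
  using assms(2,3)
proof (induction k arbitrary: f g)
  case (Suc k)
  show ?case
    by (rule Ck_on_SucI[OF \<open>open S\<close> has_derivative_add[OF
            Suc.prems[THEN Ck_on_Suc_has_derivative]]])
      (use Suc.prems in \<open>auto intro!: Suc.IH simp flip: pderiv_at_def\<close>)
qed (auto intro: continuous_on_add)

lemma Ck_on_bounded_linear:
  assumes "open S" "bounded_linear h" "Ck_on k S f"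
  shows "Ck_on k S (\<lambda>x. h (f x))"
  using assms(3)
proof (induction k arbitrary: f)
  case 0
  then show ?case by (auto intro: bounded_linear.continuous_on[OF assms(2)])
next
  case (Suc k)
  show ?case
    by (rule Ck_on_SucI[OF \<open>open S\<close> bounded_linear.has_derivative[OF assms(2) Suc.prems[THEN Ck_on_Suc_has_derivative]]])
      (use Suc.prems in \<open>auto intro!: Suc.IH simp flip: pderiv_at_def\<close>)
qed

lemma Ck_on_bounded_bilinear:
  assumes "bounded_bilinear h" "open S" "Ck_on k S f" "Ck_on k S g"
  shows "Ck_on k S (\<lambda>x. h (f x) (g x))"
  using assms(3,4)
proof (induction k arbitrary: f g)
  case 0
  then show ?case by (auto intro: bounded_bilinear.continuous_on[OF assms(1)])
next
  case (Suc k)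
  show ?case
    by (rule Ck_on_SucI[OF \<open>open S\<close> bounded_bilinear.FDERIV[OF
            assms(1) Suc.prems[THEN Ck_on_Suc_has_derivative]]])
      \<comment> \<open>The product rule leaves one factor undifferentiated, and the induction
        hypothesis needs that factor at the lower order.\<close>
      (use Suc.prems Suc.prems[THEN Ck_on_SucD] in
        \<open>simp_all add: Ck_on_add[OF \<open>open S\<close>] Suc.IH flip: pderiv_at_def\<close>)
qed

section \<open>Closure properties of smooth maps\<close>

lemma smooth_map_on_const: "open S \<Longrightarrow> smooth_map_on S (\<lambda>x. c)"
  by (simp add: smooth_map_on_def Ck_on_const)

lemma smooth_map_on_add:
  "open S \<Longrightarrow> smooth_map_on S f \<Longrightarrow> smooth_map_on S g \<Longrightarrow> smooth_map_on S (\<lambda>x. f x + g x)"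
  by (simp add: smooth_map_on_def Ck_on_add)

lemma smooth_map_on_bounded_linear:
  "bounded_linear h \<Longrightarrow> open S \<Longrightarrow> smooth_map_on S f \<Longrightarrow> smooth_map_on S (\<lambda>x. h (f x))"
  by (simp add: smooth_map_on_def Ck_on_bounded_linear)

lemma smooth_map_on_bounded_bilinear:
  "bounded_bilinear h \<Longrightarrow> open S \<Longrightarrow> smooth_map_on S f \<Longrightarrow> smooth_map_on S g \<Longrightarrow>
    smooth_map_on S (\<lambda>x. h (f x) (g x))"
  by (simp add: smooth_map_on_def Ck_on_bounded_bilinear)

lemma smooth_map_on_sum:
  "open S \<Longrightarrow> (\<And>i. i \<in> I \<Longrightarrow> smooth_map_on S (f i)) \<Longrightarrow> smooth_map_on S (\<lambda>x. \<Sum>i\<in>I. f i x)"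
  by (induction I rule: infinite_finite_induct)
    (auto intro: smooth_map_on_const smooth_map_on_add)

lemma smooth_map_on_has_derivative:
  "smooth_map_on S f \<Longrightarrow> x \<in> S \<Longrightarrow> (f has_derivative frechet_derivative f (at x)) (at x)"
  unfolding smooth_map_on_def using Ck_on_Suc_has_derivative by blast

lemma smooth_map_on_pderiv_at: "smooth_map_on S f \<Longrightarrow> smooth_map_on S (pderiv_at f i)"
  unfolding smooth_map_on_def by (metis Ck_on.simps(2))

lemma linear_sum_axis:
  fixes f :: "real^'n \<Rightarrow> 'b::real_vector"
  assumes "linear f"
  shows "f v = (\<Sum>i\<in>UNIV. v $ i *\<^sub>R f (axis i 1))"
proof -
  have "f v = f (\<Sum>i\<in>UNIV. v $ i *s axis i 1)" by (simp add: basis_expansion)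
  then show ?thesis
    by (simp add: linear_sum[OF assms] linear_scale[OF assms] scalar_mult_eq_scaleR)
qed

lemma frechet_derivative_eq_sum_pderiv_at:
  assumes "f differentiable (at x)"
  shows "frechet_derivative f (at x) v = (\<Sum>i\<in>UNIV. v $ i *\<^sub>R pderiv_at f i x)"
  unfolding pderiv_at_def by (rule linear_sum_axis[OF linear_frechet_derivative[OF assms]])

lemma smooth_map_on_cong:
  "open S \<Longrightarrow> (\<And>x. x \<in> S \<Longrightarrow> f x = g x) \<Longrightarrow> smooth_map_on S f \<longleftrightarrow> smooth_map_on S g"
  unfolding smooth_map_on_def using Ck_on_cong by blast

lemma smooth_map_on_frechet_derivative:
  assumes "open S" "smooth_map_on S f"
  shows "smooth_map_on S (\<lambda>x. frechet_derivative f (at x) v)"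
proof -
  have "smooth_map_on S (\<lambda>x. \<Sum>i\<in>UNIV. v $ i *\<^sub>R pderiv_at f i x)"
    by (intro smooth_map_on_sum \<open>open S\<close> smooth_map_on_bounded_linear[OF bounded_linear_scaleR_right]
        smooth_map_on_pderiv_at assms)
  moreover have "frechet_derivative f (at x) v = (\<Sum>i\<in>UNIV. v $ i *\<^sub>R pderiv_at f i x)" if "x \<in> S" for x
    using smooth_map_on_has_derivative[OF assms(2) that]
    by (intro frechet_derivative_eq_sum_pderiv_at) (auto simp: differentiable_def)
  ultimately show ?thesis
    by (subst smooth_map_on_cong[OF \<open>open S\<close>])
qed

text \<open>The derivative is a product of \<open>f\<close> with smooth coefficients. It therefore
  has the order already known for \<open>f\<close>, and \<open>f\<close> gains one order.\<close>

lemma smooth_map_on_bootstrap: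
  assumes "bounded_bilinear h" "open S" "\<And>x. x \<in> S \<Longrightarrow> (f has_derivative (\<lambda>v. h (f x) (\<Omega> x v))) (at x)"
    "\<And>i. smooth_map_on S (\<lambda>x. \<Omega> x (axis i 1))"
  shows "smooth_map_on S f"
proof -
  have "Ck_on k S f" for k
  proof (induction k)
    case 0
    have "continuous_on S f"
      by (rule has_derivative_continuous_on[OF has_derivative_at_withinI[OF assms(3)]])
    then show ?case by simp
  next
    case (Suc k)
    show ?case
    proof (rule Ck_on_SucI[OF assms(2,3)])
      show "Ck_on k S (\<lambda>x. h (f x) (\<Omega> x (axis i 1)))" for i
        using assms(4) by (intro Ck_on_bounded_bilinear[OF assms(1,2) Suc]) (simp add: smooth_map_on_def)
    qed
  qed
  then show ?thesis by (simp add: smooth_map_on_def)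
qed

section \<open>Symmetry of second derivatives\<close>

text \<open>The second difference is an increment in direction \<open>v\<close> of an increment in
  direction \<open>u\<close>. The mean value inequality in \<open>v\<close> leaves differences of
  values of \<open>f' _ v\<close>, and differentiability of this map at the single point
  \<open>x\<close> replaces them by \<open>s *\<^sub>R f'' u\<close>.\<close>

lemma second_difference_bound:
  fixes f :: "'a::real_normed_vector \<Rightarrow> 'b::real_normed_vector"
  assumes f: "\<And>z. (f has_derivative f' z) (at z)"
    and f'': "((\<lambda>z. f' z v) has_derivative f'') (at x)" and "\<epsilon> > 0"
  shows "\<exists>\<delta>>0. \<forall>s. 0 < s \<and> s < \<delta> \<longrightarrow>
    norm (f (x + s *\<^sub>R u + s *\<^sub>R v) - f (x + s *\<^sub>R u) - f (x + s *\<^sub>R v) + f x - s\<^sup>2 *\<^sub>R f'' u) \<le> \<epsilon> * s\<^sup>2"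
proof -
  interpret f'': bounded_linear f'' using f'' by (rule has_derivative_bounded_linear)
  define c where "c = norm u + norm v + 1"
  have "c > 0" by (simp add: c_def add_nonneg_pos)
  \<comment> \<open>Each of two linearization errors will be at most
    \<open>\<eta> * (s * c)\<close>; the factor 2 makes their sum
    \<open>\<epsilon> * s\<close>.\<close>
  define \<eta> where "\<eta> = \<epsilon> / (2 * c)"
  have "\<eta> > 0" using \<open>\<epsilon> > 0\<close> \<open>c > 0\<close> by (simp add: \<eta>_def)
  obtain d where "d > 0" and d: "\<And>y. norm (y - x) < d \<Longrightarrow> norm (f' y v - f' x v - f'' (y - x)) \<le> \<eta> * norm (y - x)"
    using f'' \<open>\<eta> > 0\<close> unfolding has_derivative_at_alt by meson
  show ?thesis
  proof (intro exI[of _ "d / c"] conjI allI impI)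
    show "d / c > 0" using \<open>d > 0\<close> \<open>c > 0\<close> by simp
    fix s :: real assume s: "0 < s \<and> s < d / c"
    have sc: "s * c < d" using s \<open>c > 0\<close> by (simp add: field_simps)
    \<comment> \<open>\<open>h s - h 0\<close> is exactly the quantity to be estimated, so a bound
      for the derivative of \<open>h\<close> is enough.\<close>
    define h where "h t = f (x + s *\<^sub>R u + t *\<^sub>R v) - f (x + t *\<^sub>R v) - (t * s) *\<^sub>R f'' u" for t
    have h: "(h has_vector_derivative
        (f' (x + s *\<^sub>R u + t *\<^sub>R v) v - f' (x + t *\<^sub>R v) v - s *\<^sub>R f'' u)) (at t within {0..s})" for t
    proof -
      have 1: "((\<lambda>t. f (w + t *\<^sub>R v)) has_vector_derivative f' (w + t *\<^sub>R v) v) (at t within {0..s})" for w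
      proof -
        have "((\<lambda>t. f (w + t *\<^sub>R v)) has_derivative (\<lambda>r. f' (w + t *\<^sub>R v) (r *\<^sub>R v))) (at t within {0..s})"
          by (rule has_derivative_compose[of "\<lambda>t. w + t *\<^sub>R v" "\<lambda>r. r *\<^sub>R v" _ _ f, OF _ f])
            (auto intro!: derivative_eq_intros)
        then show ?thesis
          by (simp add: has_vector_derivative_def linear_scale[OF has_derivative_linear[OF f]])
      qed
      show ?thesis unfolding h_def
        by (auto intro!: derivative_eq_intros 1)
    qed
    have dist_le: "norm (a *\<^sub>R u + t *\<^sub>R v) \<le> s * c \<and> norm (a *\<^sub>R u + t *\<^sub>R v) < d"
      if "a \<in> {0..s}" "t \<in> {0..s}" for a t
    proof -
      have "norm (a *\<^sub>R u + t *\<^sub>R v) \<le> a * norm u + t * norm v"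
        using that by (intro norm_triangle_le) auto
      also have "\<dots> \<le> s * norm u + s * norm v"
        using that by (intro add_mono mult_right_mono) auto
      also have "\<dots> \<le> s * c" using s by (simp add: c_def algebra_simps)
      finally show ?thesis using sc by linarith
    qed
    have bound: "norm (f' (x + s *\<^sub>R u + t *\<^sub>R v) v - f' (x + t *\<^sub>R v) v - s *\<^sub>R f'' u) \<le> \<epsilon> * s"
      if t: "t \<in> {0..s}" for t
    proof -
      have *: "norm (f' (x + (a *\<^sub>R u + t *\<^sub>R v)) v - f' x v - f'' (a *\<^sub>R u + t *\<^sub>R v)) \<le> \<eta> * (s * c)"
        if "a \<in> {0..s}" for a
        using d[of "x + (a *\<^sub>R u + t *\<^sub>R v)"] dist_le[OF that t] \<open>\<eta> > 0\<close>
        by (auto intro: order_trans mult_left_mono)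
      have "f' (x + s *\<^sub>R u + t *\<^sub>R v) v - f' (x + t *\<^sub>R v) v - s *\<^sub>R f'' u =
          (f' (x + (s *\<^sub>R u + t *\<^sub>R v)) v - f' x v - f'' (s *\<^sub>R u + t *\<^sub>R v)) -
          (f' (x + (0 *\<^sub>R u + t *\<^sub>R v)) v - f' x v - f'' (0 *\<^sub>R u + t *\<^sub>R v))"
        by (simp add: f''.add f''.scaleR f''.zero add.assoc)
      also have "norm \<dots> \<le> \<eta> * (s * c) + \<eta> * (s * c)"
        using s by (intro norm_triangle_le_diff add_mono *) auto
      also have "\<dots> = \<epsilon> * s" using \<open>c > 0\<close> by (simp add: \<eta>_def field_simps)
      finally show ?thesis .
    qed
    have "norm (h s - h 0) \<le> (\<epsilon> * s) * norm (s - 0)"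
    proof (rule differentiable_bound[of "{0..s}" h "\<lambda>t r. r *\<^sub>R (f' (x + s *\<^sub>R u + t *\<^sub>R v) v - f' (x + t *\<^sub>R v) v - s *\<^sub>R f'' u)"])
      fix t assume t: "t \<in> {0..s}"
      show "(h has_derivative (\<lambda>r. r *\<^sub>R (f' (x + s *\<^sub>R u + t *\<^sub>R v) v - f' (x + t *\<^sub>R v) v - s *\<^sub>R f'' u)))
         (at t within {0..s})" using h[of t] by (simp add: has_vector_derivative_def)
      show "onorm (\<lambda>r. r *\<^sub>R (f' (x + s *\<^sub>R u + t *\<^sub>R v) v - f' (x + t *\<^sub>R v) v - s *\<^sub>R f'' u)) \<le> \<epsilon> * s"
        using bound[OF t] s \<open>\<epsilon> > 0\<close> by (intro onorm_le) (auto simp: mult.commute intro!: mult_left_mono)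
    qed (use s in auto)
    then show "norm (f (x + s *\<^sub>R u + s *\<^sub>R v) - f (x + s *\<^sub>R u) - f (x + s *\<^sub>R v) + f x - s\<^sup>2 *\<^sub>R f'' u) \<le> \<epsilon> * s\<^sup>2"
      using s by (simp add: h_def power2_eq_square algebra_simps)
  qed
qed

text \<open>The second difference is unchanged when \<open>u\<close> and \<open>v\<close> are
  exchanged, and after division by the square of \<open>s\<close> it approximates both mixed
  derivatives.\<close>

lemma symmetric_second_derivative:
  fixes f :: "'a::real_normed_vector \<Rightarrow> 'b::real_normed_vector"
  assumes f: "\<And>z. (f has_derivative f' z) (at z)"
    and u: "((\<lambda>z. f' z u) has_derivative f''u) (at x)"
    and v: "((\<lambda>z. f' z v) has_derivative f''v) (at x)"
  shows "f''u v = f''v u"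
proof (rule ccontr)
  assume "f''u v \<noteq> f''v u"
  \<comment> \<open>Two errors of size \<open>\<epsilon>\<close> cannot fill a gap of
    \<open>3 * \<epsilon>\<close>.\<close>
  define \<epsilon> where "\<epsilon> = norm (f''u v - f''v u) / 3"
  have "\<epsilon> > 0" using \<open>f''u v \<noteq> f''v u\<close> by (simp add: \<epsilon>_def)
  obtain d1 where d1: "d1 > 0" "\<forall>s. 0 < s \<and> s < d1 \<longrightarrow>
    norm (f (x + s *\<^sub>R u + s *\<^sub>R v) - f (x + s *\<^sub>R u) - f (x + s *\<^sub>R v) + f x - s\<^sup>2 *\<^sub>R f''v u) \<le> \<epsilon> * s\<^sup>2"
    using second_difference_bound[OF f v \<open>\<epsilon> > 0\<close>, of u] by blast
  obtain d2 where d2: "d2 > 0" "\<forall>s. 0 < s \<and> s < d2 \<longrightarrow>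
    norm (f (x + s *\<^sub>R v + s *\<^sub>R u) - f (x + s *\<^sub>R v) - f (x + s *\<^sub>R u) + f x - s\<^sup>2 *\<^sub>R f''u v) \<le> \<epsilon> * s\<^sup>2"
    using second_difference_bound[OF f u \<open>\<epsilon> > 0\<close>, of v] by blast
  define s where "s = min d1 d2 / 2"
  have s: "0 < s" "s < d1" "s < d2" using d1(1) d2(1) by (auto simp: s_def)
  let ?\<Delta> = "f (x + s *\<^sub>R u + s *\<^sub>R v) - f (x + s *\<^sub>R u) - f (x + s *\<^sub>R v) + f x"
  have a: "norm (?\<Delta> - s\<^sup>2 *\<^sub>R f''v u) \<le> \<epsilon> * s\<^sup>2" using d1(2) s by blast
  have b: "norm (?\<Delta> - s\<^sup>2 *\<^sub>R f''u v) \<le> \<epsilon> * s\<^sup>2" using d2(2) s by (simp add: algebra_simps)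
  have "s\<^sup>2 * norm (f''u v - f''v u) = norm (s\<^sup>2 *\<^sub>R (f''u v - f''v u))" by simp
  also have "s\<^sup>2 *\<^sub>R (f''u v - f''v u) = (?\<Delta> - s\<^sup>2 *\<^sub>R f''v u) - (?\<Delta> - s\<^sup>2 *\<^sub>R f''u v)"
    by (simp add: algebra_simps)
  also have "norm \<dots> \<le> \<epsilon> * s\<^sup>2 + \<epsilon> * s\<^sup>2" by (intro norm_triangle_le_diff add_mono a b)
  finally have "s\<^sup>2 * norm (f''u v - f''v u) \<le> s\<^sup>2 * (2 * \<epsilon>)" by (simp add: algebra_simps)
  then have "norm (f''u v - f''v u) \<le> 2 * \<epsilon>" using s by simp
  then show False using \<open>\<epsilon> > 0\<close> by (simp add: \<epsilon>_def)
qed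

section \<open>Total linear differential systems\<close>

text \<open>The squared norm is used because the norm is not differentiable at 0. The inequality 2 e
  |u| \<le> e^2 + |u|^2 turns the inhomogeneity into the summand 1 of the rate
  \<open>2 * M + 1\<close>, which the exponential weight absorbs.\<close>

lemma gronwall_norm:
  fixes u :: "real \<Rightarrow> 'a::real_inner"
  assumes u: "\<And>t. t \<in> {0..1} \<Longrightarrow> (u has_vector_derivative u' t) (at t within {0..1})"
    and le: "\<And>t. t \<in> {0..1} \<Longrightarrow> norm (u' t) \<le> M * norm (u t) + e"
    and "u 0 = 0" "M \<ge> 0" "e \<ge> 0"
  shows "norm (u 1) \<le> e * exp (M + 1)"
proof -
  define c where "c = 2 * M + 1"
  define h where "h t = exp (- (c * t)) * (u t \<bullet> u t) - e\<^sup>2 * t" for t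
  have "continuous_on {0..1} u"
    using u by (intro continuous_on_vector_derivative) auto
  then have "continuous_on {0..1} h" unfolding h_def by (intro continuous_intros)
  moreover have "\<exists>y. (h has_real_derivative y) (at t) \<and> y \<le> 0" if "0 < t" "t < 1" for t
  proof -
    have "(u has_vector_derivative u' t) (at t)"
      using u[of t] that by (simp add: at_within_Icc_at)
    then have 1: "(u has_derivative (\<lambda>r. r *\<^sub>R u' t)) (at t)" by (simp add: has_vector_derivative_def)
    have "((\<lambda>t. u t \<bullet> u t) has_real_derivative 2 * (u t \<bullet> u' t)) (at t)"
      unfolding has_field_derivative_def
      by (rule derivative_eq_intros 1)+ (auto simp: inner_commute algebra_simps)
    then have "(h has_real_derivative
        (exp (- (c * t)) * (2 * (u t \<bullet> u' t) - c * (u t \<bullet> u t)) - e\<^sup>2)) (at t)"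
      unfolding h_def by (auto intro!: derivative_eq_intros simp: algebra_simps)
    moreover have "2 * (u t \<bullet> u' t) - c * (u t \<bullet> u t) \<le> e\<^sup>2"
    proof -
      have "u t \<bullet> u' t \<le> norm (u t) * norm (u' t)" by (rule norm_cauchy_schwarz)
      also have "\<dots> \<le> norm (u t) * (M * norm (u t) + e)" using le[of t] that by (intro mult_left_mono) auto
      finally have "2 * (u t \<bullet> u' t) \<le> 2 * M * (norm (u t))\<^sup>2 + 2 * e * norm (u t)"
        by (simp add: algebra_simps power2_eq_square)
      moreover have "2 * e * norm (u t) \<le> e\<^sup>2 + (norm (u t))\<^sup>2" using sum_squares_bound[of e "norm (u t)"] by simp
      ultimately show ?thesis by (simp add: c_def power2_norm_eq_inner algebra_simps)
    qed
    then have "exp (- (c * t)) * (2 * (u t \<bullet> u' t) - c * (u t \<bullet> u t)) \<le> 1 * e\<^sup>2"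
    proof -
      have "exp (- (c * t)) * (2 * (u t \<bullet> u' t) - c * (u t \<bullet> u t)) \<le> exp (- (c * t)) * e\<^sup>2"
        using \<open>_ \<le> e\<^sup>2\<close> by (intro mult_left_mono) auto
      also have "\<dots> \<le> 1 * e\<^sup>2" using that \<open>M \<ge> 0\<close> by (intro mult_right_mono) (auto simp: c_def)
      finally show ?thesis .
    qed
    ultimately show ?thesis by (intro exI conjI) auto
  qed
  ultimately have "h 1 \<le> h 0"
    by (intro DERIV_nonpos_imp_decreasing_open[of 0 1 h]) auto
  then have "exp (- c) * (norm (u 1))\<^sup>2 \<le> e\<^sup>2" using \<open>u 0 = 0\<close> by (simp add: h_def power2_norm_eq_inner)
  then have "(norm (u 1))\<^sup>2 \<le> e\<^sup>2 * exp c" by (simp add: exp_minus field_simps)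
  \<comment> \<open>Rounding the exponent up makes the right-hand side a square.\<close>
  also have "\<dots> \<le> e\<^sup>2 * exp (2 * (M + 1))" by (intro mult_left_mono) (auto simp: c_def)
  also have "\<dots> = (e * exp (M + 1))\<^sup>2" by (simp only: power_mult_distrib exp_double)
  finally show ?thesis using \<open>e \<ge> 0\<close> by (meson abs_le_square_iff exp_ge_zero mult_nonneg_nonneg power2_le_imp_le)
qed

lemma has_integral_power_01: "((\<lambda>s::real. s ^ k) has_integral 1 / real (Suc k)) {0..1}"
proof -
  have "((\<lambda>s::real. s ^ k) has_integral (1 ^ Suc k / real (Suc k) - 0 ^ Suc k / real (Suc k))) {0..1}"
  proof (rule fundamental_theorem_of_calculus)
    show "((\<lambda>s::real. s ^ Suc k / real (Suc k)) has_vector_derivative x ^ k) (at x within {0..1})" for x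
      using DERIV_cdivide[OF DERIV_pow[of "Suc k" x "{0..1}"], of "real (Suc k)"]
      by (simp add: has_real_derivative_iff_has_vector_derivative del: of_nat_Suc power_Suc)
  qed simp
  then show ?thesis by simp
qed

text \<open>
  The system \<open>dy = y \<Omega>\<close>.  Integrating it along the segment from \<open>0\<close> to \<open>x\<close> gives the equation
  \<open>y x = y\<^sub>0 + \<integral>\<^sub>0\<^sup>1 y (s x) \<Omega>\<^bsub>s x\<^esub>(x) ds\<close>, whose solution is the sum of the iterated integrals below.
\<close>

locale linear_system = bounded_bilinear mul
  for mul :: "'b::euclidean_space \<Rightarrow> 'c::real_normed_vector \<Rightarrow> 'b" +
  fixes \<Omega> :: "'a::euclidean_space \<Rightarrow> 'a \<Rightarrow>\<^sub>L 'c" and y0 :: 'b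
  assumes continuous_form: "continuous_on UNIV \<Omega>"
begin

primrec iterate :: "nat \<Rightarrow> 'a \<Rightarrow> 'b" where
  "iterate 0 x = y0"
| "iterate (Suc k) x = integral {0..1} (\<lambda>s. mul (iterate k (s *\<^sub>R x)) (\<Omega> (s *\<^sub>R x) x))"

definition sol :: "'a \<Rightarrow> 'b" where "sol x = (\<Sum>k. iterate k x)"

section \<open>Continuity and convergence of the iterated integrals\<close>

lemma continuous_form_compose: "continuous_on S g \<Longrightarrow> continuous_on S (\<lambda>x. \<Omega> (g x))"
  using continuous_on_compose2[OF continuous_form] by auto

lemma continuous_iterate: "continuous_on UNIV (iterate k)"
proof (induction k)
  case (Suc k)
  have "continuous_on (UNIV \<times> cbox 0 1) (\<lambda>(x, s). mul (iterate k (s *\<^sub>R x)) (\<Omega> (s *\<^sub>R x) x))"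
    unfolding case_prod_beta
    by (intro continuous_on continuous_form_compose continuous_on_compose2[OF Suc]
        blinfun.continuous_on continuous_intros) auto
  from integral_continuous_on_param[OF this] show ?case by simp
qed (simp add: continuous_on_const)

lemma continuous_iterate_compose: "continuous_on S g \<Longrightarrow> continuous_on S (\<lambda>x. iterate k (g x))"
  using continuous_on_compose2[OF continuous_iterate] by auto

text \<open>By compactness one constant serves a whole ball. Base point and direction are kept apart
  because along a ray only the base point shrinks.\<close>

lemma radial_bound:
  obtains M where "M \<ge> 0" "\<And>z x c. norm z \<le> R \<Longrightarrow> norm (mul c (\<Omega> z x)) \<le> norm c * (M * norm x)"
proof -
  obtain K where K: "K \<ge> 0" "\<And>a b. norm (mul a b) \<le> norm a * norm b * K"
    using nonneg_bounded by blast
  have "bounded (\<Omega> ` cball 0 R)"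
    by (intro compact_imp_bounded compact_continuous_image continuous_form_compose continuous_on_id compact_cball)
  then obtain L where L: "L > 0" "\<And>z. norm z \<le> R \<Longrightarrow> norm (\<Omega> z) \<le> L"
    by (auto simp: bounded_pos)
  show ?thesis
  proof
    show "L * K \<ge> 0" using L K by simp
    fix z x :: 'a and c :: 'b assume "norm z \<le> R"
    have "norm (\<Omega> z x) \<le> L * norm x"
      using norm_blinfun[of "\<Omega> z" x] L(2)[OF \<open>norm z \<le> R\<close>] by (meson mult_right_mono norm_ge_zero order_trans)
    then have "norm c * norm (\<Omega> z x) * K \<le> norm c * (L * norm x) * K"
      using K by (intro mult_right_mono mult_left_mono) auto
    with K(2)[of c "\<Omega> z x"] show "norm (mul c (\<Omega> z x)) \<le> norm c * (L * K * norm x)"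
      by (simp add: algebra_simps)
  qed
qed

text \<open>At \<open>s *\<^sub>R x\<close> the bound of order \<open>k\<close> contains the factor
  \<open>s ^ k\<close>, whose integral supplies the next factor of the factorial.\<close>

lemma iterate_bound:
  assumes M: "M \<ge> 0" "\<And>z x c. norm z \<le> R \<Longrightarrow> norm (mul c (\<Omega> z x)) \<le> norm c * (M * norm x)"
    and "norm x \<le> R"
  shows "norm (iterate k x) \<le> norm y0 * (M * norm x) ^ k / fact k"
  using \<open>norm x \<le> R\<close>
proof (induction k arbitrary: x)
  case (Suc k)
  define C where "C = norm y0 * (M * norm x) ^ Suc k / fact k"
  have le: "norm (mul (iterate k (s *\<^sub>R x)) (\<Omega> (s *\<^sub>R x) x)) \<le> s ^ k * C" if s: "s \<in> {0..1}" for s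
  proof -
    have "norm (s *\<^sub>R x) \<le> norm x" using s by (simp add: mult_left_le_one_le)
    then have sx: "norm (s *\<^sub>R x) \<le> R" using Suc.prems by linarith
    have "norm (mul (iterate k (s *\<^sub>R x)) (\<Omega> (s *\<^sub>R x) x)) \<le> norm (iterate k (s *\<^sub>R x)) * (M * norm x)"
      by (rule M(2)[OF sx])
    also have "\<dots> \<le> (norm y0 * (M * norm (s *\<^sub>R x)) ^ k / fact k) * (M * norm x)"
      using M(1) by (intro mult_right_mono Suc.IH sx) auto
    also have "\<dots> = s ^ k * C" using s by (simp add: C_def field_simps power_mult_distrib)
    finally show ?thesis .
  qed
  have int: "((\<lambda>s. s ^ k * C) has_integral (1 / real (Suc k) * C)) {0..1}"
    by (intro has_integral_mult_left has_integral_power_01)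
  have "norm (iterate (Suc k) x) \<le> integral {0..1} (\<lambda>s. s ^ k * C)"
    unfolding iterate.simps
    by (intro integral_norm_bound_integral le integrable_continuous_real continuous_on
        continuous_form_compose blinfun.continuous_on continuous_iterate_compose continuous_intros)
      auto
  also have "\<dots> = 1 / real (Suc k) * C" using int by (rule integral_unique)
  also have "\<dots> = norm y0 * (M * norm x) ^ Suc k / fact (Suc k)" by (simp add: C_def field_simps)
  finally show ?case .
qed simp

text \<open>The exponential series is a majorant. Its rate depends on the ball, hence uniformity on
  balls only; this is enough for continuity and for limits under integrals along rays.\<close>

lemma uniform_limit_iterate:
  "uniform_limit (cball 0 R) (\<lambda>n x. \<Sum>k<n. iterate k x) sol sequentially"
proof -
  obtain M where M: "M \<ge> 0" "\<And>z x c. norm z \<le> R \<Longrightarrow> norm (mul c (\<Omega> z x)) \<le> norm c * (M * norm x)"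
    using radial_bound[of R] by metis
  show ?thesis
    unfolding sol_def
  proof (rule Weierstrass_m_test)
    show "norm (iterate k x) \<le> norm y0 * ((M * R) ^ k /\<^sub>R fact k)" if "x \<in> cball 0 R" for k x
    proof -
      have "norm x \<le> R" using that by simp
      then have "norm (iterate k x) \<le> norm y0 * (M * norm x) ^ k / fact k"
        by (intro iterate_bound[where M = M and R = R] M)
      also have "\<dots> \<le> norm y0 * (M * R) ^ k / fact k"
        using M(1) \<open>norm x \<le> R\<close> by (intro divide_right_mono mult_left_mono power_mono) auto
      finally show ?thesis by (simp add: divide_inverse algebra_simps)
    qed
    show "summable (\<lambda>k. norm y0 * ((M * R) ^ k /\<^sub>R fact k))"
      by (intro summable_mult summable_exp_generic)
  qed
qed

lemma continuous_sol: "continuous_on UNIV sol"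
proof -
  have "continuous_on (cball 0 R) sol" for R
    by (rule uniform_limit_theorem[OF _ uniform_limit_iterate])
      (auto intro!: always_eventually continuous_on_sum continuous_iterate_compose continuous_on_id)
  then have "isCont sol x" for x
    using continuous_on_interior[of "cball 0 (norm x + 1)" sol x] by simp
  then show ?thesis by (simp add: continuous_on_eq_continuous_at)
qed

lemma continuous_sol_compose: "continuous_on S g \<Longrightarrow> continuous_on S (\<lambda>x. sol (g x))"
  using continuous_on_compose2[OF continuous_sol] by auto

text \<open>The partial sums satisfy the equation up to a shift of the index by one, and uniform
  convergence on a ball containing the segment permits the limit under the integral.\<close>

lemma sol_integral_equation:
  "sol x = y0 + integral {0..1} (\<lambda>s. mul (sol (s *\<^sub>R x)) (\<Omega> (s *\<^sub>R x) x))"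
proof -
  let ?S = "\<lambda>n x. \<Sum>k<n. iterate k x"
  have cont: "continuous_on {0..1} (\<lambda>s. mul (g (s *\<^sub>R x)) (\<Omega> (s *\<^sub>R x) x))"
    if "continuous_on UNIV g" for g
    by (intro continuous_on continuous_form_compose blinfun.continuous_on continuous_intros
        continuous_on_compose2[OF that]) auto
  obtain M where M: "M \<ge> 0" "\<And>z u c. norm z \<le> norm x \<Longrightarrow> norm (mul c (\<Omega> z u)) \<le> norm c * (M * norm u)"
    using radial_bound[of "norm x"] by metis
  have cS: "continuous_on UNIV (?S n)" for n
    by (intro continuous_on_sum continuous_iterate)
  have lim: "uniform_limit {0..1} (\<lambda>n s. mul (?S n (s *\<^sub>R x)) (\<Omega> (s *\<^sub>R x) x))
      (\<lambda>s. mul (sol (s *\<^sub>R x)) (\<Omega> (s *\<^sub>R x) x)) sequentially"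
  proof (rule uniform_limitI)
    fix e :: real assume "e > 0"
    \<comment> \<open>The summand 1 keeps the denominator positive when \<open>M * norm x\<close> is
      0.\<close>
    define d where "d = e / (M * norm x + 1)"
    have p: "M * norm x + 1 > 0" using M(1) by (simp add: add_nonneg_pos)
    have "d > 0" using \<open>e > 0\<close> p by (simp add: d_def)
    have "\<forall>\<^sub>F n in sequentially. \<forall>z\<in>cball 0 (norm x). dist (?S n z) (sol z) < d"
      using uniform_limitD[OF uniform_limit_iterate \<open>d > 0\<close>] .
    then show "\<forall>\<^sub>F n in sequentially. \<forall>s\<in>{0..1}.
        dist (mul (?S n (s *\<^sub>R x)) (\<Omega> (s *\<^sub>R x) x)) (mul (sol (s *\<^sub>R x)) (\<Omega> (s *\<^sub>R x) x)) < e"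
    proof (eventually_elim, intro ballI)
      fix n s assume *: "\<forall>z\<in>cball 0 (norm x). dist (?S n z) (sol z) < d" and s: "s \<in> {0..1::real}"
      have sx: "norm (s *\<^sub>R x) \<le> norm x" using s by (simp add: mult_left_le_one_le)
      have "dist (mul (?S n (s *\<^sub>R x)) (\<Omega> (s *\<^sub>R x) x)) (mul (sol (s *\<^sub>R x)) (\<Omega> (s *\<^sub>R x) x))
          \<le> norm (?S n (s *\<^sub>R x) - sol (s *\<^sub>R x)) * (M * norm x)"
        unfolding dist_norm using M(2)[OF sx] by (simp flip: diff_left)
      also have "\<dots> \<le> d * (M * norm x)"
        using *[rule_format, of "s *\<^sub>R x"] sx M(1) by (intro mult_right_mono) (auto simp: dist_norm)
      also have "\<dots> < d * (M * norm x + 1)" using \<open>d > 0\<close> by simp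
      also have "\<dots> = e" using p by (simp add: d_def)
      finally show "dist (mul (?S n (s *\<^sub>R x)) (\<Omega> (s *\<^sub>R x) x)) (mul (sol (s *\<^sub>R x)) (\<Omega> (s *\<^sub>R x) x)) < e" .
    qed
  qed
  obtain I J where I: "\<And>n. ((\<lambda>s. mul (?S n (s *\<^sub>R x)) (\<Omega> (s *\<^sub>R x) x)) has_integral I n) {0..1}"
    and J: "((\<lambda>s. mul (sol (s *\<^sub>R x)) (\<Omega> (s *\<^sub>R x) x)) has_integral J) {0..1}" and "I \<longlonglongrightarrow> J"
    using uniform_limit_integral[OF lim cont[OF cS]] by auto
  have "?S (Suc n) x = y0 + I n" for n
  proof -
    have "?S (Suc n) x = y0 + (\<Sum>k<n. iterate (Suc k) x)"
      by (subst sum.lessThan_Suc_shift) simp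
    also have "(\<Sum>k<n. iterate (Suc k) x) = integral {0..1} (\<lambda>s. \<Sum>k<n. mul (iterate k (s *\<^sub>R x)) (\<Omega> (s *\<^sub>R x) x))"
      unfolding iterate.simps
      by (intro integral_sum[symmetric] integrable_continuous_real cont continuous_iterate) auto
    also have "\<dots> = I n" using integral_unique[OF I[of n]] by (simp add: sum_left)
    finally show ?thesis .
  qed
  moreover have "(\<lambda>n. ?S (Suc n) x) \<longlonglongrightarrow> sol x"
    using tendsto_uniform_limitI[OF uniform_limit_iterate[of "norm x"], of x]
    by (intro LIMSEQ_Suc) simp
  ultimately have "(\<lambda>n. y0 + I n) \<longlonglongrightarrow> sol x" by simp
  moreover have "(\<lambda>n. y0 + I n) \<longlonglongrightarrow> y0 + J" using \<open>I \<longlonglongrightarrow> J\<close> by (intro tendsto_intros)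
  ultimately have "sol x = y0 + J" by (rule LIMSEQ_unique)
  then show ?thesis using integral_unique[OF J] by simp
qed

lemma sol_zero: "sol 0 = y0"
  using sol_integral_equation[of 0] by (simp add: zero_right blinfun.zero_right)

text \<open>Substituting t s for s turns the integral equation at t x into one with a fixed
  integrand and upper limit t, to which the fundamental theorem of calculus applies.\<close>

lemma sol_radial_derivative:
  assumes "t \<in> {0..1}"
  shows "((\<lambda>t. sol (t *\<^sub>R x)) has_vector_derivative mul (sol (t *\<^sub>R x)) (\<Omega> (t *\<^sub>R x) x)) (at t within {0..1})"
proof -
  define g where "g r = mul (sol (r *\<^sub>R x)) (\<Omega> (r *\<^sub>R x) x)" for r
  have "sol (t *\<^sub>R x) = y0 + integral {0..t} g" if "t \<in> {0..1}" for t
  \<comment> \<open>The substitution divides by \<open>t\<close>; at the origin the value of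
    \<open>sol\<close> is known.\<close>
  proof (cases "t = 0")
    case False
    with that have "t > 0" by simp
    then have img: "(\<lambda>s. s / t) ` {0..t} = {0..1}"
      by (simp add: image_divide_atLeastAtMost)
    have "integral {0..1} (\<lambda>s. mul (sol (s *\<^sub>R (t *\<^sub>R x))) (\<Omega> (s *\<^sub>R (t *\<^sub>R x)) (t *\<^sub>R x)))
        = integral {0..1} (\<lambda>s. t *\<^sub>R g (t * s))"
      by (simp add: g_def blinfun.scaleR_right scaleR_right mult.commute)
    also have "\<dots> = t *\<^sub>R integral {0..1} (\<lambda>s. g (t * s))" by simp
    also have "integral {0..1} (\<lambda>s. g (t * s)) = (1 / t) *\<^sub>R integral {0..t} g"
      using integral_stretch_real[of t 0 t g] \<open>t > 0\<close> by (simp add: img)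
    finally show ?thesis using sol_integral_equation[of "t *\<^sub>R x"] \<open>t > 0\<close> by simp
  qed (simp add: sol_zero)
  moreover have "((\<lambda>t. y0 + integral {0..t} g) has_vector_derivative 0 + g t) (at t within {0..1})"
    unfolding g_def
    by (intro has_vector_derivative_add has_vector_derivative_const integral_has_vector_derivative assms
        continuous_on continuous_form_compose blinfun.continuous_on continuous_intros continuous_sol_compose)
  ultimately show ?thesis
    using assms by (auto intro: has_vector_derivative_transform simp: g_def)
qed

end

text \<open>\<open>\<Omega>' x u v\<close> is the derivative in direction \<open>u\<close> of the
  coefficient on \<open>v\<close>, so the first difference is the exterior derivative. The type
  \<open>'c\<close> carries no product of its own, which is why flatness is imposed on the action on
  \<open>'b\<close>.\<close>

locale flat_linear_system = linear_system mul \<Omega> y0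
  for mul :: "'b::euclidean_space \<Rightarrow> 'c::real_normed_vector \<Rightarrow> 'b"
    and \<Omega> :: "'a::euclidean_space \<Rightarrow> 'a \<Rightarrow>\<^sub>L 'c" and y0 +
  fixes \<Omega>' :: "'a \<Rightarrow> 'a \<Rightarrow>\<^sub>L 'a \<Rightarrow>\<^sub>L 'c"
  assumes form_has_derivative: "(\<Omega> has_derivative \<Omega>' x) (at x)"
    and continuous_form_derivative: "continuous_on UNIV \<Omega>'"
    and flat: "mul c (\<Omega>' x u v) - mul c (\<Omega>' x v u)
      + mul (mul c (\<Omega> x u)) (\<Omega> x v) - mul (mul c (\<Omega> x v)) (\<Omega> x u) = 0"
begin

text \<open>
  The defect \<open>D s = y (s (x + v)) - y (s x) - s y (s x) \<Omega>\<^bsub>s x\<^esub>(v)\<close> of the linear approximation satisfies,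
  by flatness, \<open>D' = D \<Omega>\<^bsub>s x\<^esub>(x) + o(v)\<close>; hence \<open>D 1 = o(v)\<close>.
\<close>

lemma defect_has_vector_derivative:
  fixes x v :: 'a and s :: real
  assumes "s \<in> {0..1}"
  defines "p \<equiv> sol (s *\<^sub>R (x + v))" and "q \<equiv> sol (s *\<^sub>R x)"
    and "W \<equiv> \<Omega> (s *\<^sub>R x)" and "W' \<equiv> \<Omega>' (s *\<^sub>R x)"
  shows "((\<lambda>s. sol (s *\<^sub>R (x + v)) - sol (s *\<^sub>R x) - s *\<^sub>R mul (sol (s *\<^sub>R x)) (\<Omega> (s *\<^sub>R x) v)) has_vector_derivative
    mul (p - q - s *\<^sub>R mul q (W v)) (W x) + mul (p - q) (W v + s *\<^sub>R W' v x)
      + mul p (\<Omega> (s *\<^sub>R (x + v)) (x + v) - W x - W v - s *\<^sub>R W' v x)) (at s within {0..1})"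
proof -
  have 1: "((\<lambda>s. \<Omega> (s *\<^sub>R x) v) has_vector_derivative W' x v) (at s within {0..1})"
  proof -
    have "((\<lambda>s. \<Omega> (s *\<^sub>R x)) has_derivative (\<lambda>r. \<Omega>' (s *\<^sub>R x) (r *\<^sub>R x))) (at s within {0..1})"
      by (rule has_derivative_compose[OF _ form_has_derivative]) (auto intro!: derivative_eq_intros)
    then have "((\<lambda>s. \<Omega> (s *\<^sub>R x) v) has_derivative (\<lambda>r. \<Omega>' (s *\<^sub>R x) (r *\<^sub>R x) v)) (at s within {0..1})"
      by (rule bounded_linear.has_derivative[OF blinfun.bounded_linear_left])
    then show ?thesis
      by (simp add: has_vector_derivative_def W'_def blinfun.scaleR_right blinfun.scaleR_left)
  qed
  have 2: "((\<lambda>s. mul (sol (s *\<^sub>R x)) (\<Omega> (s *\<^sub>R x) v)) has_vector_derivative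
      mul q (W' x v) + mul (mul q (W x)) (W v)) (at s within {0..1})"
    using has_vector_derivative[OF sol_radial_derivative[OF assms(1), of x] 1] by (simp add: q_def W_def)
  have 3: "((\<lambda>s. s *\<^sub>R mul (sol (s *\<^sub>R x)) (\<Omega> (s *\<^sub>R x) v)) has_vector_derivative
      s *\<^sub>R (mul q (W' x v) + mul (mul q (W x)) (W v)) + 1 *\<^sub>R mul q (W v)) (at s within {0..1})"
    using has_vector_derivative_scaleR[OF DERIV_ident 2] by (simp add: q_def W_def)
  \<comment> \<open>Flatness exchanges \<open>x\<close> and \<open>v\<close> in the derivative of
    the linear term along the ray. The new product ending in \<open>W x\<close> is what completes
    the defect acted on by \<open>W x\<close>.\<close>
  have 4: "mul q (W' x v) + mul (mul q (W x)) (W v) = mul q (W' v x) + mul (mul q (W v)) (W x)"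
    using flat[of q "s *\<^sub>R x" x v] by (simp add: W_def W'_def algebra_simps)
  \<comment> \<open>Besides the defect there remain two terms of order o(v): the small difference
    \<open>p - q\<close> times something linear in \<open>v\<close>, and the first-order remainder
    of the form.\<close>
  have "mul p (\<Omega> (s *\<^sub>R (x + v)) (x + v)) - mul q (W x)
      - (s *\<^sub>R (mul q (W' x v) + mul (mul q (W x)) (W v)) + 1 *\<^sub>R mul q (W v)) =
    mul (p - q - s *\<^sub>R mul q (W v)) (W x) + mul (p - q) (W v + s *\<^sub>R W' v x)
      + mul p (\<Omega> (s *\<^sub>R (x + v)) (x + v) - W x - W v - s *\<^sub>R W' v x)"
    unfolding 4 by (simp add: add_left add_right diff_left diff_right scaleR_left scaleR_right algebra_simps)
  then show ?thesis
    using has_vector_derivative_diff[OF has_vector_derivative_diff[OF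
          sol_radial_derivative[OF assms(1), of "x + v"] sol_radial_derivative[OF assms(1), of x]] 3]
    by (simp add: p_def q_def W_def)
qed

text \<open>Continuity of \<open>sol\<close> suffices, because increments of \<open>sol\<close>
  enter the error only together with a factor linear in \<open>v\<close>; so differentiability is
  not presupposed. On a compact ball all continuity is uniform, which makes the error uniform along
  the ray.\<close>

theorem sol_has_derivative: "(sol has_derivative (\<lambda>v. mul (sol x) (\<Omega> x v))) (at x)"
  unfolding has_derivative_at_alt
proof (intro conjI allI impI)
  show "bounded_linear (\<lambda>v. mul (sol x) (\<Omega> x v))"
    by (intro bounded_linear_compose[OF bounded_linear_right] blinfun.bounded_linear_right)
  obtain K where K: "K \<ge> 0" "\<And>a b. norm (mul a b) \<le> norm a * norm b * K"
    using nonneg_bounded by blast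
  \<comment> \<open>The margin 1 keeps all points s x + t v with |v| < 1 in the ball.\<close>
  define R where "R = norm x + 1"
  have bdd: "\<exists>C\<ge>0. \<forall>z. norm z \<le> R \<longrightarrow> norm (f z) \<le> C" if "continuous_on UNIV f" for f :: "'a \<Rightarrow> 'd::real_normed_vector"
  proof -
    have "bounded (f ` cball 0 R)"
      by (intro compact_imp_bounded compact_continuous_image continuous_on_subset[OF that]) auto
    then obtain C where "C > 0" "\<And>z. norm z \<le> R \<Longrightarrow> norm (f z) \<le> C" by (auto simp: bounded_pos)
    then show ?thesis by (intro exI[of _ C]) auto
  qed
  have unif: "\<exists>\<delta>>0. \<forall>z w. norm z \<le> R \<and> norm w \<le> R \<and> norm (w - z) < \<delta> \<longrightarrow> norm (f w - f z) \<le> \<epsilon>"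
    if "continuous_on UNIV f" "\<epsilon> > 0" for f :: "'a \<Rightarrow> 'd::real_normed_vector" and \<epsilon>
  proof -
    have "uniformly_continuous_on (cball 0 R) f"
      by (intro compact_uniformly_continuous continuous_on_subset[OF that(1)]) auto
    then obtain \<delta> where "\<delta> > 0" "\<forall>z\<in>cball 0 R. \<forall>w\<in>cball 0 R. dist w z < \<delta> \<longrightarrow> dist (f w) (f z) < \<epsilon>"
      unfolding uniformly_continuous_on_def using \<open>\<epsilon> > 0\<close> by blast
    then show ?thesis by (intro exI[of _ \<delta>]) (auto simp: dist_norm intro: less_imp_le)
  qed
  obtain L where L: "L \<ge> 0" "\<And>z. norm z \<le> R \<Longrightarrow> norm (\<Omega> z) \<le> L" using bdd[OF continuous_form] by blast
  obtain L' where L': "L' \<ge> 0" "\<And>z. norm z \<le> R \<Longrightarrow> norm (\<Omega>' z) \<le> L'"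
    using bdd[OF continuous_form_derivative] by blast
  obtain Y where Y: "Y \<ge> 0" "\<And>z. norm z \<le> R \<Longrightarrow> norm (sol z) \<le> Y" using bdd[OF continuous_sol] by blast
  \<comment> \<open>\<open>M\<close> is the rate of the homogeneous term. \<open>N\<close> collects
    the error in units of \<open>\<epsilon> * norm v\<close>: \<open>L + L' * norm x\<close>
    multiplies the increment of \<open>sol\<close>, and \<open>Y\<close> multiplies the remainder of
    the form.\<close>
  define M where "M = L * norm x * K"
  define N where "N = (L + L' * norm x + Y * (norm x + 1)) * K"
  have "M \<ge> 0" "N \<ge> 0" using K L L' Y by (auto simp: M_def N_def)
  fix e :: real assume "e > 0"
  have pos: "N * exp (M + 1) + 1 > 0" using \<open>N \<ge> 0\<close> by (simp add: add_nonneg_pos)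
  \<comment> \<open>Cancels the factor produced by the Gronwall estimate; the summand 1 covers
    \<open>N = 0\<close>.\<close>
  define \<epsilon> where "\<epsilon> = e / (N * exp (M + 1) + 1)"
  have "\<epsilon> > 0" using \<open>e > 0\<close> pos by (simp add: \<epsilon>_def)
  obtain d1 where d1: "d1 > 0" "\<And>z w. norm z \<le> R \<Longrightarrow> norm w \<le> R \<Longrightarrow> norm (w - z) < d1 \<Longrightarrow> norm (sol w - sol z) \<le> \<epsilon>"
    using unif[OF continuous_sol \<open>\<epsilon> > 0\<close>] by blast
  obtain d2 where d2: "d2 > 0" "\<And>z w. norm z \<le> R \<Longrightarrow> norm w \<le> R \<Longrightarrow> norm (w - z) < d2 \<Longrightarrow> norm (\<Omega> w - \<Omega> z) \<le> \<epsilon>"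
    using unif[OF continuous_form \<open>\<epsilon> > 0\<close>] by blast
  obtain d3 where d3: "d3 > 0" "\<And>z w. norm z \<le> R \<Longrightarrow> norm w \<le> R \<Longrightarrow> norm (w - z) < d3 \<Longrightarrow> norm (\<Omega>' w - \<Omega>' z) \<le> \<epsilon>"
    using unif[OF continuous_form_derivative \<open>\<epsilon> > 0\<close>] by blast
  define d where "d = Min {1, d1, d2, d3}"
  show "\<exists>d>0. \<forall>y. norm (y - x) < d \<longrightarrow> norm (sol y - sol x - mul (sol x) (\<Omega> x (y - x))) \<le> e * norm (y - x)"
  proof (intro exI[of _ d] conjI allI impI)
    show "d > 0" using d1 d2 d3 by (simp add: d_def)
    fix y assume "norm (y - x) < d"
    define v where "v = y - x"
    have v: "norm v < 1" "norm v < d1" "norm v < d2" "norm v < d3"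
      using \<open>norm (y - x) < d\<close> by (auto simp: d_def v_def)
    have near: "norm (s *\<^sub>R x + t *\<^sub>R v) \<le> R" if "s \<in> {0..1}" "t \<in> {0..1}" for s t
    proof -
      have "norm (s *\<^sub>R x) \<le> norm x" "norm (t *\<^sub>R v) \<le> norm v"
        using that by (simp_all add: mult_left_le_one_le)
      then show ?thesis unfolding R_def using v by (intro norm_triangle_le) auto
    qed
    have near0: "norm (s *\<^sub>R x) \<le> R" if "s \<in> {0..1}" for s using near[OF that, of 0] by simp
    have small: "norm (t *\<^sub>R v) < d1 \<and> norm (t *\<^sub>R v) < d2 \<and> norm (t *\<^sub>R v) < d3" if "t \<in> {0..1}" for t
    proof -
      have "norm (t *\<^sub>R v) \<le> norm v" using that by (simp add: mult_left_le_one_le)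
      then show ?thesis using v by linarith
    qed
    define D where "D s = sol (s *\<^sub>R (x + v)) - sol (s *\<^sub>R x) - s *\<^sub>R mul (sol (s *\<^sub>R x)) (\<Omega> (s *\<^sub>R x) v)" for s
    define E where "E s = mul (sol (s *\<^sub>R (x + v)) - sol (s *\<^sub>R x)) (\<Omega> (s *\<^sub>R x) v + s *\<^sub>R \<Omega>' (s *\<^sub>R x) v x)
      + mul (sol (s *\<^sub>R (x + v))) (\<Omega> (s *\<^sub>R (x + v)) (x + v) - \<Omega> (s *\<^sub>R x) x - \<Omega> (s *\<^sub>R x) v - s *\<^sub>R \<Omega>' (s *\<^sub>R x) v x)" for s
    have "norm (D 1) \<le> (\<epsilon> * N * norm v) * exp (M + 1)"
    proof (rule gronwall_norm)
      fix s :: real assume s: "s \<in> {0..1}"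
      show "(D has_vector_derivative (mul (D s) (\<Omega> (s *\<^sub>R x) x) + E s)) (at s within {0..1})"
        using defect_has_vector_derivative[OF s, of x v] by (simp add: D_def[abs_def] E_def add.assoc)
      have sv: "s *\<^sub>R (x + v) = s *\<^sub>R x + s *\<^sub>R v" by (simp add: scaleR_add_right)
      have form: "norm (\<Omega> z w) \<le> L * norm w" if "norm z \<le> R" for z w
        using norm_blinfun[of "\<Omega> z" w] L(2)[OF that] by (meson mult_right_mono norm_ge_zero order_trans)
      have "norm (mul (D s) (\<Omega> (s *\<^sub>R x) x)) \<le> norm (D s) * norm (\<Omega> (s *\<^sub>R x) x) * K" by (rule K(2))
      also have "\<dots> \<le> norm (D s) * (L * norm x) * K"
        using K(1) by (intro mult_right_mono mult_left_mono form near0 s) auto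
      finally have a: "norm (mul (D s) (\<Omega> (s *\<^sub>R x) x)) \<le> M * norm (D s)" by (simp add: M_def mult_ac)
      have b: "norm (\<Omega> (s *\<^sub>R x) v + s *\<^sub>R \<Omega>' (s *\<^sub>R x) v x) \<le> (L + L' * norm x) * norm v"
      proof -
        have "norm (\<Omega>' (s *\<^sub>R x) v x) \<le> norm (\<Omega>' (s *\<^sub>R x) v) * norm x" by (rule norm_blinfun)
        also have "\<dots> \<le> (norm (\<Omega>' (s *\<^sub>R x)) * norm v) * norm x"
          by (intro mult_right_mono norm_blinfun) auto
        also have "\<dots> \<le> (L' * norm v) * norm x"
          by (intro mult_right_mono L' near0 s) auto
        finally have "norm (\<Omega>' (s *\<^sub>R x) v x) \<le> (L' * norm v) * norm x" .
        then have "norm (s *\<^sub>R \<Omega>' (s *\<^sub>R x) v x) \<le> (L' * norm v) * norm x"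
          using s by (auto intro: order_trans[OF mult_left_le_one_le])
        with form[OF near0[OF s], of v] show ?thesis
          by (intro norm_triangle_le) (simp add: algebra_simps)
      qed
      have c: "norm (\<Omega> (s *\<^sub>R (x + v)) (x + v) - \<Omega> (s *\<^sub>R x) x - \<Omega> (s *\<^sub>R x) v - s *\<^sub>R \<Omega>' (s *\<^sub>R x) v x)
          \<le> \<epsilon> * (norm x + 1) * norm v"
      proof -
        have "norm (\<Omega> (s *\<^sub>R x + s *\<^sub>R v) - \<Omega> (s *\<^sub>R x) - \<Omega>' (s *\<^sub>R x) ((s *\<^sub>R x + s *\<^sub>R v) - s *\<^sub>R x))
            \<le> norm ((s *\<^sub>R x + s *\<^sub>R v) - s *\<^sub>R x) * \<epsilon>"
        proof (rule differentiable_bound_linearization[where S = "(\<lambda>t. s *\<^sub>R x + t *\<^sub>R v) ` {0..1}" and f' = "\<lambda>z. \<Omega>' z"])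
          fix t :: real assume t: "t \<in> {0..1}"
          have "s * t \<in> {0..1}" using s t by (auto intro: mult_le_one)
          then show "s *\<^sub>R x + t *\<^sub>R (s *\<^sub>R x + s *\<^sub>R v - s *\<^sub>R x) \<in> (\<lambda>t. s *\<^sub>R x + t *\<^sub>R v) ` {0..1}"
            by (intro image_eqI[of _ _ "s * t"]) (auto simp: mult.commute)
        next
          fix z assume "z \<in> (\<lambda>t. s *\<^sub>R x + t *\<^sub>R v) ` {0..1}"
          then obtain t where t: "t \<in> {0..1}" "z = s *\<^sub>R x + t *\<^sub>R v" by blast
          have "norm (\<Omega>' z - \<Omega>' (s *\<^sub>R x)) \<le> \<epsilon>"
            using t s near near0 small by (intro d3) auto
          then show "onorm (blinfun_apply (\<Omega>' z) - blinfun_apply (\<Omega>' (s *\<^sub>R x))) \<le> \<epsilon>"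
            by (simp add: norm_blinfun.rep_eq minus_blinfun.rep_eq fun_diff_def)
        next
          show "s *\<^sub>R x \<in> (\<lambda>t. s *\<^sub>R x + t *\<^sub>R v) ` {0..1}" by (intro image_eqI[of _ _ 0]) auto
        qed (rule has_derivative_at_withinI[OF form_has_derivative])
        then have "norm (\<Omega> (s *\<^sub>R x + s *\<^sub>R v) - \<Omega> (s *\<^sub>R x) - s *\<^sub>R \<Omega>' (s *\<^sub>R x) v) \<le> norm (s *\<^sub>R v) * \<epsilon>"
          by (simp add: blinfun.scaleR_right)
        also have "\<dots> \<le> norm v * \<epsilon>" using s \<open>\<epsilon> > 0\<close> by (intro mult_right_mono) (auto simp: mult_left_le_one_le)
        finally have 1: "norm (\<Omega> (s *\<^sub>R x + s *\<^sub>R v) - \<Omega> (s *\<^sub>R x) - s *\<^sub>R \<Omega>' (s *\<^sub>R x) v) \<le> norm v * \<epsilon>" .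
        have 2: "norm ((\<Omega> (s *\<^sub>R x + s *\<^sub>R v) - \<Omega> (s *\<^sub>R x) - s *\<^sub>R \<Omega>' (s *\<^sub>R x) v) x) \<le> norm v * \<epsilon> * norm x"
          by (rule order_trans[OF norm_blinfun]) (intro mult_right_mono 1 norm_ge_zero)
        have 3: "norm (\<Omega> (s *\<^sub>R x + s *\<^sub>R v) - \<Omega> (s *\<^sub>R x)) \<le> \<epsilon>"
          using s near near0 small by (intro d2) auto
        have 4: "norm ((\<Omega> (s *\<^sub>R x + s *\<^sub>R v) - \<Omega> (s *\<^sub>R x)) v) \<le> \<epsilon> * norm v"
          by (rule order_trans[OF norm_blinfun]) (intro mult_right_mono 3 norm_ge_zero)
        \<comment> \<open>On \<open>x\<close> the change of the form must be known to first order;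
          on \<open>v\<close>, which is itself small, continuity of the form is enough.\<close>
        have "\<Omega> (s *\<^sub>R (x + v)) (x + v) - \<Omega> (s *\<^sub>R x) x - \<Omega> (s *\<^sub>R x) v - s *\<^sub>R \<Omega>' (s *\<^sub>R x) v x =
          (\<Omega> (s *\<^sub>R x + s *\<^sub>R v) - \<Omega> (s *\<^sub>R x) - s *\<^sub>R \<Omega>' (s *\<^sub>R x) v) x + (\<Omega> (s *\<^sub>R x + s *\<^sub>R v) - \<Omega> (s *\<^sub>R x)) v"
          by (simp add: sv blinfun.diff_left blinfun.add_right blinfun.scaleR_left)
        also have "norm \<dots> \<le> \<epsilon> * (norm x + 1) * norm v"
          using 2 4 by (intro norm_triangle_le) (simp add: algebra_simps)
        finally show ?thesis .
      qed
      have d: "norm (sol (s *\<^sub>R (x + v)) - sol (s *\<^sub>R x)) \<le> \<epsilon>"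
        unfolding sv using s near near0 small by (intro d1) auto
      have f: "norm (sol (s *\<^sub>R (x + v))) \<le> Y" unfolding sv using s near by (intro Y) auto
      have "norm (E s) \<le> \<epsilon> * ((L + L' * norm x) * norm v) * K + Y * (\<epsilon> * (norm x + 1) * norm v) * K"
        unfolding E_def
        by (intro norm_triangle_le add_mono order_trans[OF K(2)] mult_right_mono mult_mono b c d f)
          (use K L L' Y \<open>\<epsilon> > 0\<close> in auto)
      also have "\<dots> = \<epsilon> * N * norm v" by (simp add: N_def algebra_simps)
      finally show "norm (mul (D s) (\<Omega> (s *\<^sub>R x) x) + E s) \<le> M * norm (D s) + \<epsilon> * N * norm v"
        using a by (intro norm_triangle_le) linarith
    next
      show "D 0 = 0" by (simp add: D_def)
      show "M \<ge> 0" by fact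
      show "\<epsilon> * N * norm v \<ge> 0" using \<open>\<epsilon> > 0\<close> \<open>N \<ge> 0\<close> by simp
    qed
    also have "\<dots> = (N * exp (M + 1)) * (\<epsilon> * norm v)" by simp
    also have "\<dots> \<le> (N * exp (M + 1) + 1) * (\<epsilon> * norm v)" using \<open>\<epsilon> > 0\<close> by (intro mult_right_mono) auto
    also have "\<dots> = e * norm v" using pos by (simp add: \<epsilon>_def)
    finally show "norm (sol y - sol x - mul (sol x) (\<Omega> x (y - x))) \<le> e * norm (y - x)"
      by (simp add: D_def v_def)
  qed
qed

end

section \<open>Flat connections and closed forms\<close>

text \<open>Written so that the dependence on \<open>c\<close> is visibly bounded linear: smooth
  families of values then give families that are smooth in the operator norm.\<close>

definition blinfun_of_values :: "('n::finite \<Rightarrow> 'b::real_normed_vector) \<Rightarrow> (real^'n) \<Rightarrow>\<^sub>L 'b"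
  where "blinfun_of_values c = (\<Sum>i\<in>UNIV. blinfun_scaleR_left (c i) o\<^sub>L blinfun_inner_left (axis i 1))"

lemma blinfun_of_values_apply: "blinfun_of_values c v = (\<Sum>i\<in>UNIV. v $ i *\<^sub>R c i)"
  by (simp add: blinfun_of_values_def blinfun.sum_left inner_axis)

lemma smooth_map_on_blinfun_of_values:
  assumes "open S" "\<And>i. smooth_map_on S (\<lambda>x. c x i)"
  shows "smooth_map_on S (\<lambda>x. blinfun_of_values (c x))"
  unfolding blinfun_of_values_def
  by (intro smooth_map_on_sum assms smooth_map_on_bounded_linear[OF bounded_linear_compose[OF
          bounded_bilinear.bounded_linear_left[OF bounded_bilinear_blinfun_compose] bounded_linear_blinfun_scaleR_left]])

lemma smooth_map_on_imp_continuous_on: "smooth_map_on S f \<Longrightarrow> continuous_on S f"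
  unfolding smooth_map_on_def using Ck_on.simps(1) by blast

lemma smooth_map_on_has_blinfun_derivative:
  assumes "smooth_map_on S f" "x \<in> S"
  shows "(f has_derivative blinfun_of_values (\<lambda>i. pderiv_at f i x)) (at x)"
proof -
  have 1: "(f has_derivative frechet_derivative f (at x)) (at x)"
    by (rule smooth_map_on_has_derivative[OF assms])
  then have "frechet_derivative f (at x) = blinfun_of_values (\<lambda>i. pderiv_at f i x)"
    by (intro ext) (simp add: blinfun_of_values_apply frechet_derivative_eq_sum_pderiv_at differentiableI)
  with 1 show ?thesis by simp
qed

text \<open>Finitely many values on axis vectors determine the form, which upgrades smoothness on
  each fixed vector to smoothness in the operator norm. The solution is global because the iterated
  integrals converge on every ball.\<close>

theorem flat_system_solvable:
  fixes mul :: "'b::euclidean_space \<Rightarrow> 'c::real_normed_vector \<Rightarrow> 'b"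
    and \<omega> :: "real^'n \<Rightarrow> real^'n \<Rightarrow> 'c"
  assumes mul: "bounded_bilinear mul" and \<omega>: "one_form_on UNIV \<omega>"
    and flat: "\<And>c x u v. mul c (ext_deriv \<omega> x u v) + mul (mul c (\<omega> x u)) (\<omega> x v)
      - mul (mul c (\<omega> x v)) (\<omega> x u) = 0"
  shows "\<exists>y. y 0 = y0 \<and> smooth_map_on UNIV y \<and>
    (\<forall>x. (y has_derivative (\<lambda>v. mul (y x) (\<omega> x v))) (at x))"
proof -
  define \<Omega> where "\<Omega> x = blinfun_of_values (\<lambda>i. \<omega> x (axis i 1))" for x
  define \<Omega>' where "\<Omega>' x = blinfun_of_values (\<lambda>i. pderiv_at \<Omega> i x)" for x
  have sm: "smooth_map_on UNIV (\<lambda>x. \<omega> x v)" for v using \<omega> by (simp add: one_form_on_def)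
  have \<Omega>: "\<Omega> x v = \<omega> x v" for x v
    using \<omega> linear_sum_axis[of "\<omega> x" v] by (simp add: \<Omega>_def blinfun_of_values_apply one_form_on_def)
  have sm\<Omega>: "smooth_map_on UNIV \<Omega>"
    unfolding \<Omega>_def[abs_def] by (intro smooth_map_on_blinfun_of_values sm) simp
  have der: "(\<Omega> has_derivative \<Omega>' x) (at x)" for x
    unfolding \<Omega>'_def by (rule smooth_map_on_has_blinfun_derivative[OF sm\<Omega>]) simp
  have ext: "ext_deriv \<omega> x u v = \<Omega>' x u v - \<Omega>' x v u" for x u v
  proof -
    have "frechet_derivative (\<lambda>y. \<omega> y v) (at x) u = \<Omega>' x u v" for u v
    proof -
      have "((\<lambda>y. \<Omega> y v) has_derivative (\<lambda>u. \<Omega>' x u v)) (at x)"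
        by (rule bounded_linear.has_derivative[OF blinfun.bounded_linear_left der])
      then show ?thesis using frechet_derivative_at unfolding \<Omega> by metis
    qed
    then show ?thesis by (simp add: ext_deriv_def)
  qed
  interpret bounded_bilinear mul by (rule mul)
  interpret flat_linear_system mul \<Omega> y0 \<Omega>'
  proof
    show "continuous_on UNIV \<Omega>" by (rule smooth_map_on_imp_continuous_on[OF sm\<Omega>])
    show "(\<Omega> has_derivative \<Omega>' x) (at x)" for x by (rule der)
    show "continuous_on UNIV \<Omega>'" unfolding \<Omega>'_def[abs_def]
      by (intro smooth_map_on_imp_continuous_on smooth_map_on_blinfun_of_values smooth_map_on_pderiv_at sm\<Omega>) simp
    show "mul c (\<Omega>' x u v) - mul c (\<Omega>' x v u) + mul (mul c (\<Omega> x u)) (\<Omega> x v) - mul (mul c (\<Omega> x v)) (\<Omega> x u) = 0"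
      for c x u v using flat[of c x u v] by (simp add: \<Omega> ext diff_right)
  qed
  have d: "(sol has_derivative (\<lambda>v. mul (sol x) (\<omega> x v))) (at x)" for x
    using sol_has_derivative[of x] by (simp add: \<Omega>)
  show ?thesis
    using sol_zero d smooth_map_on_bootstrap[OF mul open_UNIV d sm] by blast
qed

text \<open>
  A closed form \<open>\<omega>\<close> is a flat connection acting on \<open>\<real> \<times> E\<close> by \<open>(r, f) \<omega> = (0, r \<omega>)\<close>, and the second
  component of the solution through \<open>(1, 0)\<close> is a primitive.
\<close>

theorem poincare_lemma:
  fixes \<omega> :: "real^'n \<Rightarrow> real^'n \<Rightarrow> 'e::euclidean_space"
  assumes "one_form_on UNIV \<omega>" "\<And>x u v. ext_deriv \<omega> x u v = 0"
  shows "exact_on UNIV \<omega>"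
proof -
  \<comment> \<open>A product has first component 0, so a second multiplication gives 0; the
    quadratic terms of flatness vanish and closedness remains.\<close>
  define mul :: "real \<times> 'e \<Rightarrow> 'e \<Rightarrow> real \<times> 'e" where "mul p c = (0, fst p *\<^sub>R c)" for p c
  have "bounded_bilinear mul"
    unfolding bilinear_conv_bounded_bilinear[symmetric] bilinear_def mul_def
    by (auto intro!: linearI simp: algebra_simps)
  then obtain y where y0: "y 0 = (1, 0)" and sm: "smooth_map_on UNIV y"
    and y: "\<And>x. (y has_derivative (\<lambda>v. mul (y x) (\<omega> x v))) (at x)"
    using flat_system_solvable[of mul \<omega> "(1, 0)"] assms by (auto simp: mul_def)
  have "((\<lambda>x. fst (y x)) has_derivative (\<lambda>v. 0)) (at x)" for x
    using has_derivative_fst[OF y] by (simp add: mul_def)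
  then have "\<exists>c. \<forall>x\<in>UNIV. fst (y x) = c"
    by (intro has_derivative_zero_constant) auto
  then have 1: "fst (y x) = 1" for x using y0 by (metis UNIV_I fst_conv)
  have "((\<lambda>x. snd (y x)) has_derivative \<omega> x) (at x)" for x
    using has_derivative_snd[OF y[of x]] by (simp add: mul_def 1)
  moreover have "smooth_map_on UNIV (\<lambda>x. snd (y x))"
    by (intro smooth_map_on_bounded_linear[OF bounded_linear_snd] sm) simp
  ultimately show ?thesis unfolding exact_on_def has_differential_on_def by blast
qed

section \<open>Skew connections and orthogonal frames\<close>

lemma bounded_bilinear_matrix_matrix_mult:
  "bounded_bilinear ((**) :: real^'n^'m \<Rightarrow> real^'k^'n \<Rightarrow> real^'k^'m)"
  unfolding bilinear_conv_bounded_bilinear[symmetric] bilinear_def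
  by (auto intro!: linearI simp: matrix_matrix_mult_def vec_eq_iff sum.distrib sum_distrib_left algebra_simps)

lemma bounded_linear_transpose: "bounded_linear (transpose :: real^'n^'m \<Rightarrow> real^'m^'n)"
  unfolding linear_conv_bounded_linear[symmetric]
  by (intro linearI) (auto simp: transpose_def vec_eq_iff)

lemma matrix_inv_eq_transpose:
  fixes A :: "real^'n^'n"
  assumes "orthogonal_matrix A"
  shows "matrix_inv A = transpose A"
proof -
  have "invertible A" using assms orthogonal_matrix_def invertible_def by metis
  then have "A ** matrix_inv A = mat 1"
    unfolding invertible_def matrix_inv_def by (rule someI2_ex) simp
  then have "transpose A ** (A ** matrix_inv A) = transpose A" by simp
  then show ?thesis using assms by (simp add: matrix_mul_assoc orthogonal_matrix_def)
qed

lemma trivializes_on_has_derivative: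
  assumes "trivializes_on A \<omega> S" "x \<in> S"
  shows "(A has_derivative (\<lambda>v. A x ** \<omega> x v)) (at x)"
proof -
  have "frechet_derivative A (at x) v = A x ** \<omega> x v" for v
  proof -
    have "A x ** \<omega> x v = A x ** (transpose (A x) ** frechet_derivative A (at x) v)"
      using assms by (simp add: trivializes_on_def flip: matrix_inv_eq_transpose)
    also have "\<dots> = frechet_derivative A (at x) v"
      using assms by (simp add: matrix_mul_assoc trivializes_on_def orthogonal_matrix_def)
    finally show ?thesis by simp
  qed
  then have "frechet_derivative A (at x) = (\<lambda>v. A x ** \<omega> x v)" by blast
  then show ?thesis
    using assms smooth_map_on_has_derivative[of S A x] by (simp add: trivializes_on_def)
qed

theorem flat_orthogonal_connection_trivial:
  fixes \<omega> :: "real^'n \<Rightarrow> real^'n \<Rightarrow> real^'m^'m"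
  assumes \<omega>: "one_form_on UNIV \<omega>" and so: "\<And>x v. \<omega> x v \<in> so_algebra" and "flat_form_on UNIV \<omega>"
  shows "\<exists>A. trivializes_on A \<omega> UNIV"
proof -
  interpret mm: bounded_bilinear "(**) :: real^'m^'m \<Rightarrow> real^'m^'m \<Rightarrow> real^'m^'m"
    by (rule bounded_bilinear_matrix_matrix_mult)
  have flat: "c ** ext_deriv \<omega> x u v + c ** \<omega> x u ** \<omega> x v - c ** \<omega> x v ** \<omega> x u = 0"
    for c :: "real^'m^'m" and x u v
  proof -
    have "c ** (ext_deriv \<omega> x u v + wedge_square \<omega> x u v) = c ** 0"
      using assms(3) by (simp add: flat_form_on_def)
    then show ?thesis
      by (simp add: wedge_square_def mm.add_right mm.diff_right mm.zero_right matrix_mul_assoc add_diff_eq)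
  qed
  obtain A where A0: "A 0 = mat 1" and sm: "smooth_map_on UNIV A"
    and A: "\<And>x. (A has_derivative (\<lambda>v. A x ** \<omega> x v)) (at x)"
    using flat_system_solvable[OF bounded_bilinear_matrix_matrix_mult \<omega> flat, of "mat 1"] by blast
  \<comment> \<open>The order of the factors matters: the derivative of A A^T is A (\<omega> +
    \<omega>^T) A^T, which vanishes at once, whereas that of A^T A is a commutator with
    \<omega>.\<close>
  have "((\<lambda>x. A x ** transpose (A x)) has_derivative (\<lambda>v. 0)) (at x)" for x
  proof -
    have "A x ** transpose (A x ** \<omega> x v) + A x ** \<omega> x v ** transpose (A x) = 0" for v
    proof -
      have "transpose (\<omega> x v) = - \<omega> x v" using so[of x v] by (simp add: so_algebra_def)
      then show ?thesis by (simp add: matrix_transpose_mul matrix_mul_assoc mm.minus_left mm.minus_right)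
    qed
    with mm.FDERIV[OF A bounded_linear.has_derivative[OF bounded_linear_transpose A], of x] show ?thesis
      by simp
  qed
  then have "\<exists>c. \<forall>x\<in>UNIV. A x ** transpose (A x) = c"
    by (intro has_derivative_zero_constant) auto
  then have "A x ** transpose (A x) = mat 1" for x
    using A0 by (metis UNIV_I matrix_mul_lid transpose_mat)
  then have orth: "orthogonal_matrix (A x)" for x
    by (simp add: orthogonal_matrix_def matrix_left_right_inverse)
  have "matrix_inv (A x) ** frechet_derivative A (at x) v = \<omega> x v" for x v
    using orth[of x] frechet_derivative_at[OF A[of x], symmetric]
    by (simp add: matrix_inv_eq_transpose matrix_mul_assoc orthogonal_matrix_def)
  then show ?thesis using sm orth by (auto simp: trivializes_on_def)
qed

section \<open>Immersions with a parallel normal frame in line of curvature coordinates\<close>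

lemmas smooth_map_on_scaleR = smooth_map_on_bounded_bilinear[OF bounded_bilinear_scaleR]
  and smooth_map_on_inner = smooth_map_on_bounded_bilinear[OF bounded_bilinear_inner]
  and smooth_map_on_vec_nth = smooth_map_on_bounded_linear[OF bounded_linear_vec_nth]

locale diagonal_immersion =
  fixes X :: "real^'n::finite \<Rightarrow> 'a::euclidean_space"
    and e :: "'n \<Rightarrow> real^'n \<Rightarrow> 'a" and \<nu> :: "'p::finite \<Rightarrow> real^'n \<Rightarrow> 'a"
    and a :: "real^'n \<Rightarrow> real^'n" and c :: "real^'n \<Rightarrow> real^'n^'p"
  assumes smooth_X: "smooth_map_on UNIV X" and smooth_normal: "smooth_map_on UNIV (\<nu> k)"
    and X_has_derivative: "(X has_derivative (\<lambda>v. \<Sum>i\<in>UNIV. (a x $ i * v $ i) *\<^sub>R e i x)) (at x)"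
    and normal_has_derivative: "(\<nu> k has_derivative (\<lambda>v. \<Sum>i\<in>UNIV. (c x $ k $ i * v $ i) *\<^sub>R e i x)) (at x)"
    and tangent_orthonormal: "e i x \<bullet> e j x = (if i = j then 1 else 0)"
    and normal_orthonormal: "\<nu> k x \<bullet> \<nu> l x = (if k = l then 1 else 0)"
    and tangent_normal: "e i x \<bullet> \<nu> k x = 0"
    and frame_expansion: "w = (\<Sum>i\<in>UNIV. (w \<bullet> e i x) *\<^sub>R e i x) + (\<Sum>k\<in>UNIV. (w \<bullet> \<nu> k x) *\<^sub>R \<nu> k x)"
    and a_nonzero: "a x $ i \<noteq> 0"
begin

lemma frechet_derivative_X: "frechet_derivative X (at x) v = (\<Sum>i\<in>UNIV. (a x $ i * v $ i) *\<^sub>R e i x)"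
  by (simp flip: frechet_derivative_at[OF X_has_derivative])

lemma frechet_derivative_normal:
  "frechet_derivative (\<nu> k) (at x) v = (\<Sum>i\<in>UNIV. (c x $ k $ i * v $ i) *\<^sub>R e i x)"
  by (simp flip: frechet_derivative_at[OF normal_has_derivative])

lemma tangent_normal': "\<nu> k x \<bullet> e i x = 0"
  using tangent_normal by (simp add: inner_commute)

lemma inner_tangent_sum: "(\<Sum>i\<in>UNIV. f i *\<^sub>R e i x) \<bullet> e j x = f j"
  by (simp add: inner_sum_left tangent_orthonormal sum.delta if_distrib cong: if_cong)

lemma inner_normal_sum: "(\<Sum>k\<in>UNIV. f k *\<^sub>R \<nu> k x) \<bullet> \<nu> l x = f l"
  by (simp add: inner_sum_left normal_orthonormal sum.delta if_distrib cong: if_cong)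

lemma inner_tangent_sums: "(\<Sum>i\<in>UNIV. f i *\<^sub>R e i x) \<bullet> (\<Sum>i\<in>UNIV. g i *\<^sub>R e i x) = (\<Sum>i\<in>UNIV. f i * g i)"
  by (subst inner_sum_right) (simp add: inner_tangent_sum mult.commute)

text \<open>The criterion involves the normal frame alone, which is why immersions with a common
  frame have parallel tangent planes. Division by the entries of \<open>a\<close> produces the
  preimages.\<close>

lemma tangent_plane_iff: "w \<in> tangent_plane X x \<longleftrightarrow> (\<forall>k. w \<bullet> \<nu> k x = 0)"
proof
  assume "\<forall>k. w \<bullet> \<nu> k x = 0"
  then have "w = (\<Sum>i\<in>UNIV. (w \<bullet> e i x) *\<^sub>R e i x)" using frame_expansion[of w x] by simp
  also have "\<dots> = frechet_derivative X (at x) (\<chi> i. (w \<bullet> e i x) / a x $ i)"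
    by (simp add: frechet_derivative_X a_nonzero)
  finally show "w \<in> tangent_plane X x" unfolding tangent_plane_def by blast
qed (auto simp: tangent_plane_def frechet_derivative_X inner_sum_left tangent_normal)

lemma tangent_in_tangent_plane: "e i x \<in> tangent_plane X x"
  by (simp add: tangent_plane_iff tangent_normal)

lemma normal_plane_iff: "w \<in> normal_plane X x \<longleftrightarrow> (\<forall>i. w \<bullet> e i x = 0)"
proof
  assume "w \<in> normal_plane X x"
  then show "\<forall>i. w \<bullet> e i x = 0"
    using tangent_in_tangent_plane
    by (auto simp: normal_plane_def orthogonal_comp_def orthogonal_def inner_commute)
next
  assume "\<forall>i. w \<bullet> e i x = 0"
  then show "w \<in> normal_plane X x"
    by (auto simp: normal_plane_def orthogonal_comp_def orthogonal_def tangent_plane_def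
        frechet_derivative_X inner_sum_left inner_commute[of _ w])
qed

lemma normal_plane_expansion:
  "w \<in> normal_plane X x \<Longrightarrow> w = (\<Sum>k\<in>UNIV. (w \<bullet> \<nu> k x) *\<^sub>R \<nu> k x)"
  using frame_expansion[of w x] by (simp add: normal_plane_iff)

lemma normal_part_eq: "normal_part X x w = (\<Sum>k\<in>UNIV. (w \<bullet> \<nu> k x) *\<^sub>R \<nu> k x)"
  unfolding normal_part_def
proof (rule the_equality)
  show "(\<Sum>k\<in>UNIV. (w \<bullet> \<nu> k x) *\<^sub>R \<nu> k x) \<in> normal_plane X x \<and>
      w - (\<Sum>k\<in>UNIV. (w \<bullet> \<nu> k x) *\<^sub>R \<nu> k x) \<in> tangent_plane X x"
    by (simp add: normal_plane_iff tangent_plane_iff inner_diff_left inner_normal_sum)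
      (simp add: inner_sum_left tangent_normal')
next
  fix z assume "z \<in> normal_plane X x \<and> w - z \<in> tangent_plane X x"
  then show "z = (\<Sum>k\<in>UNIV. (w \<bullet> \<nu> k x) *\<^sub>R \<nu> k x)"
    using normal_plane_expansion[of z x] by (simp add: tangent_plane_iff inner_diff_left)
qed

lemma normal_sum_in_normal_plane: "(\<Sum>k\<in>UNIV. f k *\<^sub>R \<nu> k x) \<in> normal_plane X x"
  by (simp add: normal_plane_iff inner_sum_left tangent_normal')

lemma immersion: "immersion_on UNIV X"
proof -
  have "u = v" if "frechet_derivative X (at x) u = frechet_derivative X (at x) v" for x u v
  proof -
    have "a x $ i * u $ i = a x $ i * v $ i" for i
      using arg_cong[OF that, of "\<lambda>w. w \<bullet> e i x"] by (simp add: frechet_derivative_X inner_tangent_sum)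
    then show ?thesis by (simp add: vec_eq_iff a_nonzero)
  qed
  then show ?thesis by (auto simp: immersion_on_def smooth_X intro: injI)
qed

lemma parallel_normal_frame: "parallel_normal_frame_on UNIV X \<nu>"
proof -
  have in_normal: "\<nu> k x \<in> normal_plane X x" for k x by (simp add: normal_plane_iff tangent_normal')
  have "span (range (\<lambda>k. \<nu> k x)) = normal_plane X x" for x
  proof
    show "span (range (\<lambda>k. \<nu> k x)) \<subseteq> normal_plane X x"
      unfolding normal_plane_def
      by (intro span_minimal subspace_orthogonal_comp) (use in_normal in \<open>auto simp: normal_plane_def\<close>)
    show "normal_plane X x \<subseteq> span (range (\<lambda>k. \<nu> k x))"
    proof
      fix w assume "w \<in> normal_plane X x"
      then have "w = (\<Sum>k\<in>UNIV. (w \<bullet> \<nu> k x) *\<^sub>R \<nu> k x)" by (rule normal_plane_expansion)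
      also have "\<dots> \<in> span (range (\<lambda>k. \<nu> k x))"
        by (intro span_sum span_scale span_base) auto
      finally show "w \<in> span (range (\<lambda>k. \<nu> k x))" .
    qed
  qed
  then show ?thesis
    unfolding parallel_normal_frame_on_def parallel_normal_field_on_def normal_field_on_def normal_deriv_def
    by (auto simp: smooth_normal in_normal normal_orthonormal normal_part_eq frechet_derivative_normal
        inner_sum_left tangent_normal)
qed

text \<open>The derivative of \<open>\<nu> k\<close> is tangential and hence orthogonal to
  \<open>\<xi>\<close>. So in this frame the normal connection merely differentiates
  components.\<close>

lemma normal_field_derivative:
  assumes "normal_field_on UNIV X \<xi>"
  shows "((\<lambda>x. \<xi> x \<bullet> \<nu> k x) has_derivative (\<lambda>u. frechet_derivative \<xi> (at x) u \<bullet> \<nu> k x)) (at x)"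
proof -
  have "(\<xi> has_derivative frechet_derivative \<xi> (at x)) (at x)"
    using assms by (intro smooth_map_on_has_derivative) (auto simp: normal_field_on_def)
  from has_derivative_inner[OF this normal_has_derivative[of k x]]
  show ?thesis
    using assms by (simp add: inner_sum_right normal_field_on_def normal_plane_iff)
qed

text \<open>In components, commuting two normal derivatives is the symmetry of the second
  derivatives of real functions.\<close>

lemma flat_normal_bundle: "flat_normal_bundle_on UNIV X"
  unfolding flat_normal_bundle_on_def
proof (intro allI impI ballI)
  fix \<xi> x u v assume \<xi>: "normal_field_on UNIV X \<xi>"
  define \<phi> where "\<phi> k x = \<xi> x \<bullet> \<nu> k x" for k x
  define \<phi>' where "\<phi>' k x v = frechet_derivative \<xi> (at x) v \<bullet> \<nu> k x" for k x v
  have sm: "smooth_map_on UNIV (\<lambda>x. \<phi>' k x v)" for k v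
    unfolding \<phi>'_def using \<xi>
    by (intro smooth_map_on_inner smooth_map_on_frechet_derivative smooth_normal) (auto simp: normal_field_on_def)
  have \<phi>: "(\<phi> k has_derivative \<phi>' k x) (at x)" for k x
    unfolding \<phi>_def[abs_def] \<phi>'_def[abs_def] by (rule normal_field_derivative[OF \<xi>])
  have nd: "normal_deriv X v \<xi> = (\<lambda>x. \<Sum>k\<in>UNIV. \<phi>' k x v *\<^sub>R \<nu> k x)" for v
    by (simp add: fun_eq_iff normal_deriv_def normal_part_eq \<phi>'_def)
  have nf: "normal_field_on UNIV X (normal_deriv X v \<xi>)" for v
    unfolding nd normal_field_on_def
    by (intro conjI smooth_map_on_sum smooth_map_on_scaleR sm smooth_normal ballI normal_sum_in_normal_plane) auto
  \<comment> \<open>The normal derivative is again a normal field, with components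
    \<open>\<phi>' k _ v\<close>, so the component rule applies to it as well.\<close>
  have 2: "((\<lambda>x. \<phi>' k x v) has_derivative (\<lambda>u. frechet_derivative (normal_deriv X v \<xi>) (at x) u \<bullet> \<nu> k x)) (at x)" for k v
    using normal_field_derivative[OF nf[of v], of k x] by (simp add: nd inner_normal_sum)
  have "frechet_derivative (normal_deriv X v \<xi>) (at x) u \<bullet> \<nu> k x
      = frechet_derivative (normal_deriv X u \<xi>) (at x) v \<bullet> \<nu> k x" for k
    by (rule symmetric_second_derivative[OF \<phi> 2 2])
  then show "normal_deriv X u (normal_deriv X v \<xi>) x = normal_deriv X v (normal_deriv X u \<xi>) x"
    by (simp add: normal_deriv_def[of X _ "normal_deriv X _ \<xi>"] normal_part_eq)
qed

text \<open>The metric sees only squares, so \<open>b\<close> may differ from \<open>a\<close> by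
  signs; the second form is linear in \<open>a\<close>, so \<open>d\<close> is tied to
  \<open>a\<close> itself.\<close>

lemma fundamental_forms:
  assumes "\<And>x i. (b x $ i)\<^sup>2 = (a x $ i)\<^sup>2" "\<And>x k i. d x $ k $ i = c x $ k $ i * a x $ i"
  shows "fundamental_forms_on UNIV X \<nu> b d"
  unfolding fundamental_forms_on_def
proof (intro ballI allI conjI)
  fix x u v
  show "first_form X x u v = (\<Sum>i\<in>UNIV. (b x $ i)\<^sup>2 * (u $ i * v $ i))"
    by (simp add: first_form_def frechet_derivative_X inner_tangent_sums assms(1)) (simp add: power2_eq_square mult_ac)
  have "second_form X \<nu> x u v = (\<Sum>k\<in>UNIV. (\<Sum>i\<in>UNIV. d x $ k $ i * (u $ i * v $ i)) *\<^sub>R \<nu> k x)"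
    unfolding second_form_def
  proof (rule sum.cong)
    fix k
    have "frechet_derivative (\<nu> k) (at x) u \<bullet> frechet_derivative X (at x) v = (\<Sum>i\<in>UNIV. d x $ k $ i * (u $ i * v $ i))"
      by (simp add: frechet_derivative_X frechet_derivative_normal inner_tangent_sums assms(2) mult_ac)
    then show "(frechet_derivative (\<nu> k) (at x) u \<bullet> frechet_derivative X (at x) v) *\<^sub>R \<nu> k x
        = (\<Sum>i\<in>UNIV. d x $ k $ i * (u $ i * v $ i)) *\<^sub>R \<nu> k x" by simp
  qed simp
  also have "\<dots> = (\<Sum>k\<in>UNIV. \<Sum>i\<in>UNIV. (d x $ k $ i * (u $ i * v $ i)) *\<^sub>R \<nu> k x)"
    by (simp only: scaleR_sum_left)
  also have "\<dots> = (\<Sum>i\<in>UNIV. \<Sum>k\<in>UNIV. (d x $ k $ i * (u $ i * v $ i)) *\<^sub>R \<nu> k x)"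
    by (rule sum.swap)
  finally show "second_form X \<nu> x u v = (\<Sum>i\<in>UNIV. \<Sum>k\<in>UNIV. (d x $ k $ i * (u $ i * v $ i)) *\<^sub>R \<nu> k x)" .
qed

text \<open>Differentiating <dX h, \<nu>_k> = 0 in direction u gives <d^2X (u, h), \<nu>_k> = - <dX
  h, d\<nu>_k u>, which is diagonal. Of the two factors a_i in the metric one cancels and the other
  becomes the divisor.\<close>

lemma shape_operator_eq:
  assumes "w \<in> normal_plane X x"
  shows "shape_operator X x w u = (\<chi> i. - ((transpose (c x) *v (\<chi> k. w \<bullet> \<nu> k x)) $ i / a x $ i) * u $ i)"
    (is "_ = ?z")
proof -
  have second: "frechet_derivative (\<lambda>y. frechet_derivative X (at y) h) (at x) u \<bullet> \<nu> k x
      = - (\<Sum>i\<in>UNIV. a x $ i * h $ i * (c x $ k $ i * u $ i))" for k h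
  proof -
    have "smooth_map_on UNIV (\<lambda>y. frechet_derivative X (at y) h)"
      by (intro smooth_map_on_frechet_derivative smooth_X) simp
    then have 1: "((\<lambda>y. frechet_derivative X (at y) h) has_derivative
        frechet_derivative (\<lambda>y. frechet_derivative X (at y) h) (at x)) (at x)"
      by (rule smooth_map_on_has_derivative) simp
    have "(\<lambda>y. frechet_derivative X (at y) h \<bullet> \<nu> k y) = (\<lambda>y. 0)"
      by (simp add: frechet_derivative_X inner_sum_left tangent_normal)
    then have "((\<lambda>y. frechet_derivative X (at y) h \<bullet> \<nu> k y) has_derivative (\<lambda>u. 0)) (at x)" by simp
    from fun_cong[OF has_derivative_unique[OF has_derivative_inner[OF 1 normal_has_derivative[of k x]] this], of u]
    show ?thesis by (simp add: frechet_derivative_X inner_tangent_sums)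
  qed
  have inner: "frechet_derivative (\<lambda>y. frechet_derivative X (at y) h) (at x) u \<bullet> w
      = - (\<Sum>i\<in>UNIV. a x $ i * h $ i * ((transpose (c x) *v (\<chi> k. w \<bullet> \<nu> k x)) $ i * u $ i))" for h
  proof -
    have "frechet_derivative (\<lambda>y. frechet_derivative X (at y) h) (at x) u \<bullet> w
        = (\<Sum>k\<in>UNIV. (w \<bullet> \<nu> k x) * (frechet_derivative (\<lambda>y. frechet_derivative X (at y) h) (at x) u \<bullet> \<nu> k x))"
      by (subst normal_plane_expansion[OF assms]) (simp add: inner_sum_right)
    also have "\<dots> = - (\<Sum>k\<in>UNIV. \<Sum>i\<in>UNIV. a x $ i * h $ i * (c x $ k $ i * (w \<bullet> \<nu> k x) * u $ i))"
      unfolding second by (simp add: sum_distrib_left sum_negf mult_ac)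
    also have "\<dots> = - (\<Sum>i\<in>UNIV. \<Sum>k\<in>UNIV. a x $ i * h $ i * (c x $ k $ i * (w \<bullet> \<nu> k x) * u $ i))"
      by (subst sum.swap) simp
    finally show ?thesis
      by (simp add: matrix_vector_mult_def transpose_def sum_distrib_left sum_distrib_right mult_ac)
  qed
  show ?thesis
    unfolding shape_operator_def inner
  proof (rule the_equality)
    show "\<forall>h. frechet_derivative X (at x) ?z \<bullet> frechet_derivative X (at x) h =
      - (\<Sum>i\<in>UNIV. a x $ i * h $ i * ((transpose (c x) *v (\<chi> k. w \<bullet> \<nu> k x)) $ i * u $ i))"
      by (simp add: frechet_derivative_X inner_tangent_sums a_nonzero sum_negf mult_ac)
  next
    fix z assume z: "\<forall>h. frechet_derivative X (at x) z \<bullet> frechet_derivative X (at x) h =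
      - (\<Sum>i\<in>UNIV. a x $ i * h $ i * ((transpose (c x) *v (\<chi> k. w \<bullet> \<nu> k x)) $ i * u $ i))"
    have "z $ i = ?z $ i" for i
    proof -
      \<comment> \<open>Testing against a single axis vector isolates one coordinate.\<close>
      have "a x $ i * (a x $ i * z $ i) = a x $ i * (- ((transpose (c x) *v (\<chi> k. w \<bullet> \<nu> k x)) $ i * u $ i))"
        using z[rule_format, of "axis i 1"]
        by (simp add: frechet_derivative_X inner_tangent_sums inner_tangent_sum axis_def if_distrib if_distribR
            sum.delta mult_ac cong: if_cong)
      then have "a x $ i * z $ i = - ((transpose (c x) *v (\<chi> k. w \<bullet> \<nu> k x)) $ i * u $ i)"
        using mult_left_cancel[OF a_nonzero[of x i]] by blast
      then show ?thesis using a_nonzero[of x i] by (simp add: field_simps)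
    qed
    then show "z = ?z" by (simp add: vec_eq_iff)
  qed
qed

text \<open>The coordinates of normal vectors fill the whole space. The shape operator applies
  \<open>transpose (c x)\<close> to them and puts the result, rescaled by nonzero factors, on a
  diagonal; this last step is injective, so the dimension is a rank.\<close>

lemma nondegenerate_normal_bundle_iff:
  "nondegenerate_normal_bundle_on UNIV X \<longleftrightarrow> (\<forall>x. rank (c x) = CARD('n))"
proof -
  have "dim ((\<lambda>w. matrix (shape_operator X x w)) ` normal_plane X x) = rank (c x)" for x
  proof -
    define diag :: "real^'n \<Rightarrow> real^'n^'n"
      where "diag t = (\<chi> r s. if r = s then - (t $ r / a x $ r) else 0)" for t
    have lin: "linear diag"
      by (intro linearI) (auto simp: diag_def vec_eq_iff add_divide_distrib)
    have inj: "inj diag"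
    proof (rule injI)
      fix s t assume "diag s = diag t"
      then have "diag s $ i $ i = diag t $ i $ i" for i by simp
      then show "s = t" using a_nonzero by (simp add: diag_def vec_eq_iff)
    qed
    have "matrix (shape_operator X x w) = diag (transpose (c x) *v (\<chi> k. w \<bullet> \<nu> k x))"
      if "w \<in> normal_plane X x" for w
      by (simp add: matrix_def shape_operator_eq[OF that] diag_def vec_eq_iff axis_def)
    then have "(\<lambda>w. matrix (shape_operator X x w)) ` normal_plane X x
        = diag ` (\<lambda>t. transpose (c x) *v t) ` (\<lambda>w. \<chi> k. w \<bullet> \<nu> k x) ` normal_plane X x"
      by (auto simp: image_image cong: image_cong)
    also have "(\<lambda>w. \<chi> k. w \<bullet> \<nu> k x) ` normal_plane X x = UNIV"
    proof -
      have "t \<in> (\<lambda>w. \<chi> k. w \<bullet> \<nu> k x) ` normal_plane X x" for t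
        by (rule image_eqI[OF _ normal_sum_in_normal_plane[of "\<lambda>k. t $ k"]])
          (simp add: inner_normal_sum vec_eq_iff)
      then show ?thesis by blast
    qed
    finally have "dim ((\<lambda>w. matrix (shape_operator X x w)) ` normal_plane X x) = dim (range (\<lambda>t. transpose (c x) *v t))"
      using dim_image_eq[OF lin, of "range (\<lambda>t. transpose (c x) *v t)"] inj by (simp add: inj_on_subset)
    then show ?thesis using rank_dim_range[of "transpose (c x)"] by (simp add: rank_transpose)
  qed
  then show ?thesis by (simp add: nondegenerate_normal_bundle_on_def)
qed

end

section \<open>The connection form of the system\<close>

lemma sum_UNIV_Plus:
  "(\<Sum>r\<in>UNIV. f r) = (\<Sum>a\<in>UNIV. f (Inl a)) + (\<Sum>k\<in>UNIV. f (Inr k))"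
  for f :: "'a::finite + 'b::finite \<Rightarrow> 'c::comm_monoid_add"
  by (simp add: sum.Plus flip: UNIV_Plus_UNIV)

lemma bilinear_eq_0_axis:
  fixes f :: "real^'n \<Rightarrow> real^'m \<Rightarrow> 'b::real_vector"
  assumes "bilinear f" "\<And>i j. f (axis i 1) (axis j 1) = 0"
  shows "f u v = 0"
proof -
  have "f (axis i 1) v = 0" for i
    using assms linear_sum_axis[of "f (axis i 1)" v] by (simp add: bilinear_def)
  then show ?thesis
    using assms(1) linear_sum_axis[of "\<lambda>u. f u v" u] by (simp add: bilinear_def)
qed

text \<open>Differentiation in the base point commutes with linear combinations of the fixed vector,
  because the form is linear at every point. This reduces flatness and closedness to axis
  vectors.\<close>

lemma bilinear_ext_deriv:
  assumes "one_form_on UNIV \<omega>"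
  shows "bilinear (ext_deriv \<omega> x)"
proof -
  have lin: "linear (\<omega> y)" for y using assms by (simp add: one_form_on_def)
  have der: "((\<lambda>y. \<omega> y v) has_derivative frechet_derivative (\<lambda>y. \<omega> y v) (at x)) (at x)" for v
    using assms by (intro smooth_map_on_has_derivative) (auto simp: one_form_on_def)
  have add: "frechet_derivative (\<lambda>y. \<omega> y (v + w)) (at x) u
      = frechet_derivative (\<lambda>y. \<omega> y v) (at x) u + frechet_derivative (\<lambda>y. \<omega> y w) (at x) u" for u v w
    using frechet_derivative_at[OF has_derivative_add[OF der[of v] der[of w]]]
    by (metis (no_types, lifting) ext linear_add[OF lin])
  have scale: "frechet_derivative (\<lambda>y. \<omega> y (r *\<^sub>R v)) (at x) u
      = r *\<^sub>R frechet_derivative (\<lambda>y. \<omega> y v) (at x) u" for r u v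
    using frechet_derivative_at[OF bounded_linear.has_derivative[OF bounded_linear_scaleR_right der[of v], of r]]
    by (metis (no_types, lifting) ext linear_scale[OF lin])
  have linu: "linear (frechet_derivative (\<lambda>y. \<omega> y v) (at x))" for v
    by (rule has_derivative_linear[OF der])
  show ?thesis
    unfolding bilinear_def ext_deriv_def
    by (auto intro!: linearI simp: add scale linear_add[OF linu] linear_scale[OF linu] scaleR_diff_right)
qed

text \<open>Both summands are antisymmetric, so only distinct axis vectors matter, and these are the
  index pairs for which the system supplies equations.\<close>

lemma flat_form_onI:
  assumes \<omega>: "one_form_on UNIV \<omega>"
    and flat: "\<And>x i j. i \<noteq> j \<Longrightarrow>
      ext_deriv \<omega> x (axis i 1) (axis j 1) + wedge_square \<omega> x (axis i 1) (axis j 1) = 0"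
  shows "flat_form_on UNIV \<omega>"
  unfolding flat_form_on_def
proof (intro ballI allI)
  fix x u v
  have lin: "linear (\<omega> x)" using \<omega> by (simp add: one_form_on_def)
  have ext: "bilinear (ext_deriv \<omega> x)" by (rule bilinear_ext_deriv[OF \<omega>])
  have "bilinear (\<lambda>u v. ext_deriv \<omega> x u v + wedge_square \<omega> x u v)"
    unfolding bilinear_def wedge_square_def
    by (auto intro!: linearI simp: bilinear_ladd[OF ext] bilinear_radd[OF ext] bilinear_lmul[OF ext]
        bilinear_rmul[OF ext] linear_add[OF lin] linear_scale[OF lin] algebra_simps
        bounded_bilinear.add_left[OF bounded_bilinear_matrix_matrix_mult]
        bounded_bilinear.add_right[OF bounded_bilinear_matrix_matrix_mult]
        bounded_bilinear.scaleR_left[OF bounded_bilinear_matrix_matrix_mult]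
        bounded_bilinear.scaleR_right[OF bounded_bilinear_matrix_matrix_mult])
  then show "ext_deriv \<omega> x u v + wedge_square \<omega> x u v = 0"
  proof (rule bilinear_eq_0_axis)
    show "ext_deriv \<omega> x (axis i 1) (axis j 1) + wedge_square \<omega> x (axis i 1) (axis j 1) = 0" for i j
      using flat[of i j] by (cases "i = j") (auto simp: ext_deriv_def wedge_square_def)
  qed
qed

section \<open>Entries, derivatives and products of the connection coefficients\<close>

lemma pderiv_at_vec_nth:
  "f differentiable (at x) \<Longrightarrow> pderiv_at (\<lambda>y. f y $ a) i x = pderiv_at f i x $ a"
  using pderiv_at_eqI[OF bounded_linear.has_derivative[OF bounded_linear_vec_nth], of f _ x a i]
  by (simp add: frechet_derivative_works pderiv_at_def)

lemma smooth_map_on_differentiable: "smooth_map_on S f \<Longrightarrow> x \<in> S \<Longrightarrow> f differentiable (at x)"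
  using smooth_map_on_has_derivative by (blast intro: differentiableI)

lemma pderiv_at_matrix_nth:
  assumes "smooth_map_on S f" "x \<in> S"
  shows "pderiv_at (\<lambda>y. f y $ a $ b) i x = pderiv_at f i x $ a $ b"
proof -
  have d: "f differentiable (at x)" using assms by (rule smooth_map_on_differentiable)
  have "(\<lambda>y. f y $ a) differentiable (at x)"
    using bounded_linear.has_derivative[OF bounded_linear_vec_nth] d unfolding differentiable_def by blast
  then show ?thesis by (simp add: pderiv_at_vec_nth d)
qed

lemma matrix_mult_C_mat_nth: "(M ** C_mat i) $ a $ b = (if b = i then M $ a $ i else 0)"
  by (cases "b = i") (simp_all add: matrix_matrix_mult_def C_mat_def if_distrib sum.delta cong: if_cong)

lemma C_mat_mult_nth: "(C_mat i ** M) $ a $ b = (if a = i then M $ i $ b else 0)"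
  by (cases "a = i") (simp_all add: matrix_matrix_mult_def C_mat_def if_distrib if_distribR sum.delta cong: if_cong)

lemma tau_form_nth:
  "tau_form F G x v $ Inl a $ Inl b = F x $ b $ a * v $ a - F x $ a $ b * v $ b"
  "tau_form F G x v $ Inl a $ Inr l = v $ a * G x $ l $ a"
  "tau_form F G x v $ Inr k $ Inl b = - (G x $ k $ b * v $ b)"
  "tau_form F G x v $ Inr k $ Inr l = 0"
  by (simp_all add: tau_form_def block_mat_def matrix_mult_C_mat_nth C_mat_mult_nth transpose_def
      mult_delta_right sum_negf right_diff_distrib sum_subtractf)

lemma tau_form_so: "tau_form F G x v \<in> so_algebra"
  unfolding so_algebra_def mem_Collect_eq vec_eq_iff split_sum_all
  by (simp add: transpose_def tau_form_nth)

lemma linear_tau_form: "linear (tau_form F G x)"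
  by (intro linearI; unfold vec_eq_iff split_sum_all) (simp_all add: tau_form_nth algebra_simps)

text \<open>The connection is linear in the pair of F and G. Constant functions turn the values
  \<open>F x\<close> and \<open>G x\<close> into arguments, so the rules for bounded linear maps
  apply to each separately.\<close>

lemma tau_form_split:
  "tau_form F G x v = tau_form (\<lambda>_. F x) (\<lambda>_. 0) 0 v + tau_form (\<lambda>_. 0) (\<lambda>_. G x) 0 v"
  unfolding vec_eq_iff split_sum_all by (simp add: tau_form_nth)

lemma bounded_linear_tau_form:
  "bounded_linear (\<lambda>M. tau_form (\<lambda>_. M) (\<lambda>_. 0) 0 v)" "bounded_linear (\<lambda>M. tau_form (\<lambda>_. 0) (\<lambda>_. M) 0 v)"
  unfolding linear_conv_bounded_linear[symmetric]
  by (intro linearI; unfold vec_eq_iff split_sum_all; simp add: tau_form_nth algebra_simps)+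

lemma one_form_on_tau_form:
  assumes "open S" "smooth_map_on S F" "smooth_map_on S G"
  shows "one_form_on S (tau_form F G)"
proof -
  have "smooth_map_on S (\<lambda>x. tau_form F G x v)" for v
    by (subst tau_form_split)
      (intro smooth_map_on_add assms smooth_map_on_bounded_linear[OF bounded_linear_tau_form(1)]
        smooth_map_on_bounded_linear[OF bounded_linear_tau_form(2)])
  then show ?thesis by (simp add: one_form_on_def linear_tau_form)
qed

lemma pderiv_at_tau_form:
  assumes "F differentiable (at x)" "G differentiable (at x)"
  shows "pderiv_at (\<lambda>y. tau_form F G y v) i x = tau_form (pderiv_at F i) (pderiv_at G i) x v"
proof -
  have "((\<lambda>y. tau_form F G y v) has_derivative (\<lambda>u.
      tau_form (\<lambda>_. frechet_derivative F (at x) u) (\<lambda>_. 0) 0 v + tau_form (\<lambda>_. 0) (\<lambda>_. frechet_derivative G (at x) u) 0 v)) (at x)"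
    by (subst tau_form_split)
      (intro has_derivative_add bounded_linear.has_derivative[OF bounded_linear_tau_form(1)]
        bounded_linear.has_derivative[OF bounded_linear_tau_form(2)]
        frechet_derivative_works[THEN iffD1] assms)
  from pderiv_at_eqI[OF this, of i] show ?thesis
    by (subst tau_form_split) (simp add: pderiv_at_def)
qed

lemma axis_nth_if: "axis i c $ j = (if j = i then c else 0)"
  by (simp add: axis_def)

text \<open>Expansion of (\<epsilon>_i w_i^T - w_i \<epsilon>_i^T)(\<epsilon>_j w_j^T - w_j
  \<epsilon>_j^T): the term with \<epsilon>_i^T \<epsilon>_j drops out, two terms carry the entries
  f_ji and f_ij, and the last one puts - w_i^T w_j at position (i, j).\<close>

lemma tau_form_product_nth:
  assumes "\<And>i. F x $ i $ i = 0" "i \<noteq> j"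
  shows "(tau_form F G x (axis i 1) ** tau_form F G x (axis j 1)) $ Inl a $ Inl b =
      (if a = i then F x $ j $ i * F x $ b $ j else 0) + (if b = j then F x $ a $ i * F x $ i $ j else 0)
      - (if a = i \<and> b = j then (\<Sum>k\<in>UNIV. F x $ k $ i * F x $ k $ j) + (\<Sum>k\<in>UNIV. G x $ k $ i * G x $ k $ j) else 0)"
    "(tau_form F G x (axis i 1) ** tau_form F G x (axis j 1)) $ Inl a $ Inr l =
      (if a = i then F x $ j $ i * G x $ l $ j else 0)"
    "(tau_form F G x (axis i 1) ** tau_form F G x (axis j 1)) $ Inr k $ Inl b =
      (if b = j then G x $ k $ i * F x $ i $ j else 0)"
    "(tau_form F G x (axis i 1) ** tau_form F G x (axis j 1)) $ Inr k $ Inr l = 0"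
  using assms
  by (cases "a = i"; cases "b = j";
      simp add: matrix_matrix_mult_def sum_UNIV_Plus tau_form_nth axis_nth_if if_distrib if_distribR
        sum.delta sum_negf left_diff_distrib right_diff_distrib sum_subtractf mult_ac cong: if_cong)+

theorem flat_tau_form:
  assumes F: "smooth_map_on UNIV F" and G: "smooth_map_on UNIV G"
    and diag: "\<And>x. F x \<in> gl_star" and sys: "G_system_II F G B UNIV"
  shows "flat_form_on UNIV (tau_form F G)"
proof (rule flat_form_onI)
  show "one_form_on UNIV (tau_form F G)" by (rule one_form_on_tau_form[OF open_UNIV F G])
  fix x and i j :: 'a assume ij: "i \<noteq> j"
  have F0: "F x $ i $ i = 0" for x i using diag[of x] by (simp add: gl_star_def)
  have DF0: "pderiv_at F k x $ i $ i = 0" for k i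
  proof -
    have "pderiv_at (\<lambda>y. F y $ i $ i) k x = 0" by (simp add: F0 pderiv_at_def)
    then show ?thesis by (simp add: pderiv_at_matrix_nth[OF F])
  qed
  have 1: "pderiv_at F i x $ i $ j + pderiv_at F j x $ j $ i + (\<Sum>k\<in>UNIV. F x $ k $ i * F x $ k $ j)
      + (\<Sum>k\<in>UNIV. G x $ k $ i * G x $ k $ j) = 0" if "i \<noteq> j" for i j
    using sys that by (simp add: G_system_II_def pderiv_at_matrix_nth[OF F])
  have 2: "pderiv_at F k x $ i $ j = F x $ i $ k * F x $ k $ j" if "i \<noteq> j" "j \<noteq> k" "i \<noteq> k" for i j k
    using sys that by (simp add: G_system_II_def pderiv_at_matrix_nth[OF F])
  have 3: "pderiv_at G k x $ i $ j = F x $ k $ j * G x $ i $ k" if "j \<noteq> k" for i j k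
    using sys that by (simp add: G_system_II_def pderiv_at_matrix_nth[OF G])
  have d: "F differentiable (at x)" "G differentiable (at x)"
    using F G by (auto intro: smooth_map_on_differentiable)
  have ji: "j \<noteq> i" using ij by simp
  have "ext_deriv (tau_form F G) x (axis i 1) (axis j 1) =
      tau_form (pderiv_at F i) (pderiv_at G i) x (axis j 1) - tau_form (pderiv_at F j) (pderiv_at G j) x (axis i 1)"
    by (simp add: ext_deriv_def pderiv_at_tau_form[OF d] flip: pderiv_at_def)
  \<comment> \<open>Positions (i, j) and (j, i) carry the first equation, and at (i, i) and (j, j)
    the two products cancel. A third index in row or column i or j leads to the second equation. The
    off-diagonal blocks treated afterwards carry the fourth.\<close>
  moreover have "tau_form (pderiv_at F i) (pderiv_at G i) x (axis j 1) $ Inl a $ Inl b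
      - tau_form (pderiv_at F j) (pderiv_at G j) x (axis i 1) $ Inl a $ Inl b
      + wedge_square (tau_form F G) x (axis i 1) (axis j 1) $ Inl a $ Inl b = 0" for a b
    using 1[OF ij]
    by (cases "a = i"; cases "a = j"; cases "b = i"; cases "b = j")
      (use ij in \<open>simp_all add: wedge_square_def tau_form_nth axis_nth_if F0 DF0 2
        tau_form_product_nth[OF F0 ij] tau_form_product_nth[OF F0 ji] mult_ac add_ac\<close>)
  moreover have "tau_form (pderiv_at F i) (pderiv_at G i) x (axis j 1) $ Inl a $ Inr l
      - tau_form (pderiv_at F j) (pderiv_at G j) x (axis i 1) $ Inl a $ Inr l
      + wedge_square (tau_form F G) x (axis i 1) (axis j 1) $ Inl a $ Inr l = 0" for a l
    using ij by (auto simp: wedge_square_def tau_form_nth axis_nth_if 3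
        tau_form_product_nth[OF F0 ij] tau_form_product_nth[OF F0 ji])
  moreover have "tau_form (pderiv_at F i) (pderiv_at G i) x (axis j 1) $ Inr k $ Inl b
      - tau_form (pderiv_at F j) (pderiv_at G j) x (axis i 1) $ Inr k $ Inl b
      + wedge_square (tau_form F G) x (axis i 1) (axis j 1) $ Inr k $ Inl b = 0" for k b
    using ij by (auto simp: wedge_square_def tau_form_nth axis_nth_if 3
        tau_form_product_nth[OF F0 ij] tau_form_product_nth[OF F0 ji])
  moreover have "wedge_square (tau_form F G) x (axis i 1) (axis j 1) $ Inr k $ Inr l = 0" for k l
    by (simp add: wedge_square_def tau_form_product_nth[OF F0 ij] tau_form_product_nth[OF F0 ji])
  ultimately show "ext_deriv (tau_form F G) x (axis i 1) (axis j 1)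
      + wedge_square (tau_form F G) x (axis i 1) (axis j 1) = 0"
    unfolding vec_eq_iff split_sum_all by (simp add: tau_form_nth(4))
qed

section \<open>The immersions\<close>

lemma ACB_form_nth:
  "ACB_form A B x v $ r $ j = (\<Sum>i\<in>UNIV. v $ i * (A x $ r $ Inl i * B x $ j $ i))"
proof -
  have "(left_cols (A x) ** C_mat i ** transpose (B x)) $ r $ j = A x $ r $ Inl i * B x $ j $ i" for i
    by (subst matrix_matrix_mult_def)
      (simp add: matrix_mult_C_mat_nth left_cols_def transpose_def mult_delta_left)
  then show ?thesis by (simp add: ACB_form_def)
qed

lemma one_form_on_ACB_form:
  assumes "open S" "smooth_map_on S A" "smooth_map_on S B"
  shows "one_form_on S (ACB_form A B)"
proof -
  have left: "bounded_linear (left_cols :: real^('a + 'b)^('a + 'b) \<Rightarrow> _)"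
    unfolding linear_conv_bounded_linear[symmetric] by (intro linearI) (simp_all add: left_cols_def vec_eq_iff)
  have "linear (ACB_form A B x)" for x
    unfolding ACB_form_def
    by (intro linearI) (simp_all add: algebra_simps sum.distrib scaleR_sum_right)
  moreover have "smooth_map_on S (\<lambda>x. ACB_form A B x v)" for v
    unfolding ACB_form_def
    by (intro smooth_map_on_sum \<open>open S\<close> smooth_map_on_bounded_linear[OF bounded_linear_scaleR_right]
        smooth_map_on_bounded_bilinear[OF bounded_bilinear_matrix_matrix_mult] smooth_map_on_const
        smooth_map_on_bounded_linear[OF left] smooth_map_on_bounded_linear[OF bounded_linear_transpose] assms)
  ultimately show ?thesis by (simp add: one_form_on_def)
qed

lemma closed_ACB_form:
  assumes B: "smooth_map_on UNIV B" and sys: "G_system_II F G B UNIV"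
    and A: "trivializes_on A (tau_form F G) UNIV"
  shows "ext_deriv (ACB_form A B) x u v = 0"
proof (rule bilinear_eq_0_axis)
  have smA: "smooth_map_on UNIV A" using A by (simp add: trivializes_on_def)
  have one: "one_form_on UNIV (ACB_form A B)" by (rule one_form_on_ACB_form[OF open_UNIV smA B])
  then show "bilinear (ext_deriv (ACB_form A B) x)" by (rule bilinear_ext_deriv)
  have sm: "smooth_map_on UNIV (\<lambda>y. ACB_form A B y v)" for v using one by (simp add: one_form_on_def)
  have dA: "pderiv_at A k x $ r $ Inl i = A x $ r $ Inl k * F x $ i $ k" if "i \<noteq> k" for i k r
    using that by (subst pderiv_at_eqI[OF trivializes_on_has_derivative[OF A]])
      (simp_all add: matrix_matrix_mult_def sum_UNIV_Plus tau_form_nth axis_nth_if mult_delta_left mult_delta_right)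
  have dB: "pderiv_at B k x $ j $ i = F x $ k $ i * B x $ j $ k" if "i \<noteq> k" for i j k
    using sys that by (simp add: G_system_II_def pderiv_at_matrix_nth[OF B])
  \<comment> \<open>The right-hand side is symmetric in \<open>i\<close> and \<open>k\<close>: the
    derivative of each factor produces the term that the other factor produces after the
    exchange.\<close>
  have *: "pderiv_at (\<lambda>y. ACB_form A B y (axis i 1)) k x $ r $ j
      = A x $ r $ Inl i * (F x $ k $ i * B x $ j $ k) + A x $ r $ Inl k * F x $ i $ k * B x $ j $ i"
    if "i \<noteq> k" for i k r j
  proof -
    have entry: "((\<lambda>y. f y $ r $ c) has_derivative (\<lambda>v. frechet_derivative f (at x) v $ r $ c)) (at x)"
      if "smooth_map_on UNIV f" for f :: "real^'a \<Rightarrow> real^'c^'d" and r c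
      by (intro bounded_linear.has_derivative[OF bounded_linear_vec_nth] smooth_map_on_has_derivative[OF that]) simp
    have "pderiv_at (\<lambda>y. ACB_form A B y (axis i 1)) k x $ r $ j
        = pderiv_at (\<lambda>y. A y $ r $ Inl i * B y $ j $ i) k x"
      by (subst pderiv_at_matrix_nth[OF sm, symmetric])
        (simp_all add: ACB_form_nth axis_nth_if mult_delta_left)
    also have "\<dots> = A x $ r $ Inl i * pderiv_at B k x $ j $ i + pderiv_at A k x $ r $ Inl i * B x $ j $ i"
      by (subst pderiv_at_eqI[OF has_derivative_mult[OF entry[OF smA] entry[OF B]]]) (simp add: pderiv_at_def)
    finally show ?thesis by (simp add: dA[OF that] dB[OF that])
  qed
  show "ext_deriv (ACB_form A B) x (axis k 1) (axis i 1) = 0" for k i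
  proof (cases "i = k")
    case False
    then show ?thesis
      using *[of i k] *[of k i] by (simp add: ext_deriv_def vec_eq_iff flip: pderiv_at_def)
  qed (simp add: ext_deriv_def)
qed

lemma orthogonal_matrix_inner_columns:
  fixes A :: "real^'n^'n"
  assumes "orthogonal_matrix A"
  shows "column i A \<bullet> column j A = (if i = j then 1 else 0)"
proof -
  have "(transpose A ** A) $ i $ j = mat 1 $ i $ j" using assms by (simp add: orthogonal_matrix)
  then show ?thesis by (simp add: matrix_matrix_mult_def transpose_def inner_vec_def column_def mat_def)
qed

lemma orthogonal_matrix_column_expansion:
  fixes A :: "real^'n^'n"
  assumes "orthogonal_matrix A"
  shows "w = (\<Sum>i\<in>UNIV. (w \<bullet> column i A) *\<^sub>R column i A)"
proof -
  have "w = A *v (transpose A *v w)"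
    using assms by (simp add: matrix_vector_mul_assoc orthogonal_matrix_def del: transpose_matrix_vector)
  also have "\<dots> = (\<Sum>i\<in>UNIV. (w \<bullet> column i A) *\<^sub>R column i A)"
    by (simp add: matrix_mult_sum scalar_mult_eq_scaleR del: transpose_matrix_vector)
      (simp add: matrix_vector_mult_def transpose_def column_def row_def inner_vec_def mult.commute)
  finally show ?thesis .
qed

lemma orthogonal_matrix_row_sum:
  fixes B :: "real^'n^'n"
  assumes "orthogonal_matrix B"
  shows "(\<Sum>i\<in>UNIV. (B $ j $ i)\<^sup>2) = 1"
proof -
  have "(B ** transpose B) $ j $ j = mat 1 $ j $ j" using assms by (simp add: orthogonal_matrix_def)
  then show ?thesis by (simp add: matrix_matrix_mult_def transpose_def mat_def power2_eq_square)
qed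

lemma bounded_linear_column: "bounded_linear (column j :: real^'n^'m \<Rightarrow> real^'m)"
  unfolding linear_conv_bounded_linear[symmetric]
  by (intro linearI) (simp_all add: column_def vec_eq_iff)

text \<open>The lower right block of the connection is 0, so the last columns of \<open>A\<close>
  have tangential derivatives with coefficients from \<open>G\<close>. The sign of
  \<open>- (B x $ j)\<close> is that of dX.\<close>

lemma diagonal_immersion_column:
  assumes A: "trivializes_on A (tau_form F G) UNIV"
    and X: "has_differential_on X (\<lambda>x v. - ACB_form A B x v) UNIV"
    and B: "\<And>x i j. B x $ i $ j \<noteq> 0"
  shows "diagonal_immersion (\<lambda>y. column j (X y)) (\<lambda>i y. column (Inl i) (A y)) (\<lambda>k y. column (Inr k) (A y))
    (\<lambda>x. - (B x $ j)) G"
proof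
  have orth: "orthogonal_matrix (A x)" for x using A by (simp add: trivializes_on_def)
  show "smooth_map_on UNIV (\<lambda>y. column j (X y))"
    using X by (intro smooth_map_on_bounded_linear[OF bounded_linear_column]) (simp_all add: has_differential_on_def)
  show "smooth_map_on UNIV (\<lambda>y. column (Inr k) (A y))" for k
    using A by (intro smooth_map_on_bounded_linear[OF bounded_linear_column]) (simp_all add: trivializes_on_def)
  show "((\<lambda>y. column j (X y)) has_derivative
      (\<lambda>v. \<Sum>i\<in>UNIV. ((- (B x $ j)) $ i * v $ i) *\<^sub>R column (Inl i) (A x))) (at x)" for x
  proof -
    have "(X has_derivative (\<lambda>v. - ACB_form A B x v)) (at x)" using X by (simp add: has_differential_on_def)
    from bounded_linear.has_derivative[OF bounded_linear_column this, of j]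
    have 1: "((\<lambda>y. column j (X y)) has_derivative (\<lambda>v. column j (- ACB_form A B x v))) (at x)" .
    have "column j (- ACB_form A B x v) = (\<Sum>i\<in>UNIV. ((- (B x $ j)) $ i * v $ i) *\<^sub>R column (Inl i) (A x))" for v
      by (simp add: vec_eq_iff column_def ACB_form_nth sum_negf mult_ac)
    then show ?thesis using 1 by simp
  qed
  show "((\<lambda>y. column (Inr k) (A y)) has_derivative
      (\<lambda>v. \<Sum>i\<in>UNIV. (G x $ k $ i * v $ i) *\<^sub>R column (Inl i) (A x))) (at x)" for x k
  proof -
    from bounded_linear.has_derivative[OF bounded_linear_column trivializes_on_has_derivative[OF A UNIV_I, of x], of "Inr k"]
    have 1: "((\<lambda>y. column (Inr k) (A y)) has_derivative (\<lambda>v. column (Inr k) (A x ** tau_form F G x v))) (at x)" .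
    have "column (Inr k) (A x ** tau_form F G x v) = (\<Sum>i\<in>UNIV. (G x $ k $ i * v $ i) *\<^sub>R column (Inl i) (A x))" for v
      by (simp add: vec_eq_iff column_def matrix_matrix_mult_def sum_UNIV_Plus tau_form_nth mult_ac)
    then show ?thesis using 1 by simp
  qed
  show "column (Inl i) (A x) \<bullet> column (Inl j) (A x) = (if i = j then 1 else 0)"
    "column (Inr k) (A x) \<bullet> column (Inr l) (A x) = (if k = l then 1 else 0)"
    "column (Inl i) (A x) \<bullet> column (Inr k) (A x) = 0" for i j k l x
    by (simp_all add: orthogonal_matrix_inner_columns[OF orth])
  show "w = (\<Sum>i\<in>UNIV. (w \<bullet> column (Inl i) (A x)) *\<^sub>R column (Inl i) (A x))
      + (\<Sum>k\<in>UNIV. (w \<bullet> column (Inr k) (A x)) *\<^sub>R column (Inr k) (A x))" for w x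
    using orthogonal_matrix_column_expansion[OF orth, of w x] by (simp add: sum_UNIV_Plus)
  show "(- (B x $ j)) $ i \<noteq> 0" for x i using B by simp
qed

theorem theorem6p8:
  fixes F :: "real^'n::finite \<Rightarrow> real^'n^'n"
    and G :: "real^'n \<Rightarrow> real^'n^'p::finite"
    and B :: "real^'n \<Rightarrow> real^'n^'n"
  assumes "smooth_map_on UNIV F" and "smooth_map_on UNIV G" and "smooth_map_on UNIV B"
    and "\<forall>x. F x \<in> gl_star" and "\<forall>x. orthogonal_matrix (B x)"
    and "G_system_II F G B UNIV"
  shows "(one_form_on UNIV (tau_form F G) \<and> (\<forall>x v. tau_form F G x v \<in> so_algebra) \<and>
          flat_form_on UNIV (tau_form F G) \<and>
          (\<exists>A. trivializes_on A (tau_form F G) UNIV)) \<and>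
         (\<forall>A. trivializes_on A (tau_form F G) UNIV \<longrightarrow>
            exact_on UNIV (ACB_form A B) \<and>
            (\<exists>X. has_differential_on X (\<lambda>x v. - ACB_form A B x v) UNIV)) \<and>
         (\<forall>A X. trivializes_on A (tau_form F G) UNIV \<longrightarrow>
            has_differential_on X (\<lambda>x v. - ACB_form A B x v) UNIV \<longrightarrow>
            (\<forall>x i j. B x $ i $ j \<noteq> 0) \<longrightarrow>
            On_tuple_pre UNIV (\<lambda>j x. column j (X x)) \<and>
            (On_tuple UNIV (\<lambda>j x. column j (X x)) \<longleftrightarrow> (\<forall>x. rank (G x) = CARD('n))) \<and>
            (\<forall>x i j. column (Inl i) (A x) \<in> tangent_plane (\<lambda>y. column j (X y)) x) \<and>
            (\<forall>x j k. tangent_plane (\<lambda>y. column j (X y)) x = tangent_plane (\<lambda>y. column k (X y)) x) \<and>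
            (\<forall>j. parallel_normal_frame_on UNIV (\<lambda>y. column j (X y)) (\<lambda>k y. column (Inr k) (A y))) \<and>
            (\<forall>j. fundamental_forms_on UNIV (\<lambda>y. column j (X y)) (\<lambda>k y. column (Inr k) (A y))
                   (\<lambda>x. B x $ j) (\<lambda>x. \<chi> k i. - (G x $ k $ i * B x $ j $ i))))"
proof (intro conjI allI impI)
  show one: "one_form_on UNIV (tau_form F G)" by (rule one_form_on_tau_form[OF open_UNIV assms(1,2)])
  show so: "tau_form F G x v \<in> so_algebra" for x v by (rule tau_form_so)
  show flat: "flat_form_on UNIV (tau_form F G)" using assms by (intro flat_tau_form) auto
  show "\<exists>A. trivializes_on A (tau_form F G) UNIV" by (rule flat_orthogonal_connection_trivial[OF one so flat])
next
  fix A assume A: "trivializes_on A (tau_form F G) UNIV"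
  then have "smooth_map_on UNIV A" by (simp add: trivializes_on_def)
  then show ex: "exact_on UNIV (ACB_form A B)"
    using closed_ACB_form[OF assms(3,6) A] assms(3) by (intro poincare_lemma one_form_on_ACB_form) auto
  then obtain f where f: "smooth_map_on UNIV f" "\<And>x. (f has_derivative ACB_form A B x) (at x)"
    by (auto simp: exact_on_def has_differential_on_def)
  then have "has_differential_on (\<lambda>x. - f x) (\<lambda>x v. - ACB_form A B x v) UNIV"
    using smooth_map_on_bounded_linear[OF bounded_linear_minus[OF bounded_linear_ident] open_UNIV f(1)]
    by (auto simp: has_differential_on_def intro: has_derivative_minus)
  then show "\<exists>X. has_differential_on X (\<lambda>x v. - ACB_form A B x v) UNIV" by blast
next
  fix A X
  assume A: "trivializes_on A (tau_form F G) UNIV"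
    and X: "has_differential_on X (\<lambda>x v. - ACB_form A B x v) UNIV" and "\<forall>x i j. B x $ i $ j \<noteq> 0"
  define Y where "Y j y = column j (X y)" for j y
  define e where "e i y = column (Inl i) (A y)" for i :: 'n and y
  define \<nu> where "\<nu> k y = column (Inr k) (A y)" for k :: 'p and y
  have D: "diagonal_immersion (Y j) e \<nu> (\<lambda>x. - (B x $ j)) G" for j
    using diagonal_immersion_column[OF A X] \<open>\<forall>x i j. B x $ i $ j \<noteq> 0\<close>
    by (auto simp: Y_def[abs_def] e_def[abs_def] \<nu>_def[abs_def])
  have tangent: "tangent_plane (Y j) x = {w. \<forall>k. w \<bullet> \<nu> k x = 0}" for j x
    using diagonal_immersion.tangent_plane_iff[OF D] by blast
  have forms: "fundamental_forms_on UNIV (Y j) \<nu> (\<lambda>x. B x $ j) (\<lambda>x. \<chi> k i. - (G x $ k $ i * B x $ j $ i))" for j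
    by (rule diagonal_immersion.fundamental_forms[OF D]) simp_all
  have frame: "parallel_normal_frame_on UNIV (Y j) \<nu>" for j
    by (rule diagonal_immersion.parallel_normal_frame[OF D])
  have smB: "smooth_map_on UNIV (\<lambda>x. B x $ j)" for j
    by (intro smooth_map_on_vec_nth assms(3)) simp
  have smG: "smooth_map_on UNIV (\<lambda>x. - G x)"
    using smooth_map_on_bounded_linear[OF bounded_linear_minus[OF bounded_linear_ident] open_UNIV assms(2)] .
  have smc: "smooth_map_on UNIV (\<lambda>x. \<chi> k i. - (G x $ k $ i * B x $ j $ i))" for j
  proof -
    have "bounded_bilinear (\<lambda>(M :: real^'n^'p) (b :: real^'n). \<chi> k i. - (M $ k $ i * b $ i))"
      unfolding bilinear_conv_bounded_bilinear[symmetric] bilinear_def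
      by (auto intro!: linearI simp: vec_eq_iff algebra_simps)
    then show ?thesis by (rule smooth_map_on_bounded_bilinear[OF _ open_UNIV assms(2) smB])
  qed
  \<comment> \<open>The rows of an orthogonal matrix have unit length, which is the spherical
    condition.\<close>
  have spherical: "spherical_curvature_coords_on UNIV (Y j) \<nu>" for j
    unfolding spherical_curvature_coords_on_def
    using frame smB smc forms orthogonal_matrix_row_sum assms(5) by blast
  show pre: "On_tuple_pre UNIV (\<lambda>j x. column j (X x))"
    unfolding On_tuple_pre_def Y_def[symmetric]
  \<comment> \<open>The coefficients of the second form are - g_ki b_ji and must equal b_ji
    \<gamma>_ki; as b_ji is nonzero, this forces \<gamma> = - G.\<close>
  proof (intro conjI allI ballI exI[of _ \<nu>] exI[of _ B] exI[of _ "\<lambda>x. - G x"])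
    show "immersion_on UNIV (Y j)" for j by (rule diagonal_immersion.immersion[OF D])
    show "flat_normal_bundle_on UNIV (Y j)" for j by (rule diagonal_immersion.flat_normal_bundle[OF D])
    show "normal_plane (Y i) x = normal_plane (Y j) x" for i j x by (simp add: normal_plane_def tangent)
    show "fundamental_forms_on UNIV (Y j) \<nu> (\<lambda>x. B x $ j) (\<lambda>x. \<chi> k i. B x $ j $ i * (- G x) $ k $ i)" for j
      using forms[of j] by (simp add: mult.commute)
  qed (use frame spherical assms smG in auto)
  \<comment> \<open>The normal frame and its coefficient matrix \<open>G\<close> are common to all
    columns, so one rank condition decides non-degeneracy for every \<open>j\<close>.\<close>
  show "On_tuple UNIV (\<lambda>j x. column j (X x)) \<longleftrightarrow> (\<forall>x. rank (G x) = CARD('n))"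
    using pre diagonal_immersion.nondegenerate_normal_bundle_iff[OF D]
    by (simp add: On_tuple_def flip: Y_def)
  show "column (Inl i) (A x) \<in> tangent_plane (\<lambda>y. column j (X y)) x" for x i j
    using diagonal_immersion.tangent_in_tangent_plane[OF D] by (simp flip: Y_def e_def)
  show "tangent_plane (\<lambda>y. column j (X y)) x = tangent_plane (\<lambda>y. column k (X y)) x" for x j k
    by (simp add: tangent flip: Y_def)
  show "parallel_normal_frame_on UNIV (\<lambda>y. column j (X y)) (\<lambda>k y. column (Inr k) (A y))" for j
    using frame by (simp flip: Y_def \<nu>_def)
  show "fundamental_forms_on UNIV (\<lambda>y. column j (X y)) (\<lambda>k y. column (Inr k) (A y))
      (\<lambda>x. B x $ j) (\<lambda>x. \<chi> k i. - (G x $ k $ i * B x $ j $ i))" for j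
    using forms by (simp flip: Y_def \<nu>_def)
qed

end
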